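(* Let $Q\subset\mathbb{R}^2$ be a rational polygon with vertex set $V$, and let $$B=\{q\in Q\setminus V:\ \text{there is no direction }\varphi\in\mathbf{S}^1\text{ for which }(q,\varphi)\text{ is a periodic point of the billiard flow}\}.$$ If $Q$ is convex, then $B$ is contained in a finite union of line segments. If $Q$ is a triangle, then $B$ is finite (possibly empty).
   Context: A polygon is rational if the angle between each pair of its sides is a rational multiple of $\pi$. The billiard flow: a point moves inside $Q$ with unit speed along straight lines and reflects at the boundary by the mirror law; trajectories hitting a vertex are continued by continuity from the left (with respect to a fixed orientation of $\partial Q$). A point $(q,\varphi)$ (position $q\in Q$, velocity direction $\varphi\in\mathbf{S}^1$) is periodic if its trajectory returns at some time $T>0$ to position $q$ with direction $\varphi$. *)

theory Defs
  imports "HOL-Analysis.Analysis"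
begin

definition vtx :: "complex list \<Rightarrow> nat \<Rightarrow> complex" where
  "vtx vs i = vs ! (i mod length vs)"

definition side :: "complex list \<Rightarrow> nat \<Rightarrow> complex set" where
  "side vs i = closed_segment (vtx vs i) (vtx vs (Suc i))"

definition side_dir :: "complex list \<Rightarrow> nat \<Rightarrow> complex" where
  "side_dir vs i = vtx vs (Suc i) - vtx vs i"

definition poly_boundary :: "complex list \<Rightarrow> complex set" where
  "poly_boundary vs = (\<Union>i<length vs. side vs i)"

definition poly_region :: "complex list \<Rightarrow> complex set" where
  "poly_region vs = poly_boundary vs \<union> inside (poly_boundary vs)"

text \<open>Simple polygon: at least 3 distinct vertices, no three consecutive vertices
collinear (so every listed vertex is a genuine corner), adjacent sides meet only
at their common vertex, non-adjacent sides are disjoint.\<close>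
definition simple_polygon :: "complex list \<Rightarrow> bool" where
  "simple_polygon vs \<longleftrightarrow>
     length vs \<ge> 3 \<and> distinct vs \<and>
     (\<forall>i<length vs. Im (cnj (side_dir vs i) * side_dir vs (Suc i)) \<noteq> 0) \<and>
     (\<forall>i<length vs. \<forall>j<length vs. i \<noteq> j \<longrightarrow>
        (if j = Suc i mod length vs then side vs i \<inter> side vs j = {vtx vs (Suc i)}
         else if i = Suc j mod length vs then side vs i \<inter> side vs j = {vtx vs i}
         else side vs i \<inter> side vs j = {}))"

definition rational_polygon :: "complex list \<Rightarrow> bool" where
  "rational_polygon vs \<longleftrightarrow> simple_polygon vs \<and>
     (\<forall>i<length vs. \<forall>j<length vs.
        \<exists>\<theta>::real. \<theta> / pi \<in> \<rat> \<and> sgn (side_dir vs j) = cis \<theta> * sgn (side_dir vs i))"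

definition flight_time :: "complex set \<Rightarrow> complex \<Rightarrow> complex \<Rightarrow> real" where
  "flight_time Q p u = Sup {t. t \<ge> 0 \<and> closed_segment p (p + of_real t * u) \<subseteq> Q}"

definition mirror :: "complex \<Rightarrow> complex \<Rightarrow> complex" where
  "mirror d z = (sgn d)^2 * cnj z"

definition in_cone :: "complex \<Rightarrow> complex \<Rightarrow> complex \<Rightarrow> bool" where
  "in_cone a b w \<longleftrightarrow> (\<exists>x y. x \<ge> 0 \<and> y \<ge> 0 \<and> w = of_real x * a + of_real y * b)"

fun corner_iter :: "complex \<Rightarrow> complex \<Rightarrow> complex \<Rightarrow> nat \<Rightarrow> complex" where
  "corner_iter m1 m2 u 0 = u"
| "corner_iter m1 m2 u (Suc k) = corner_iter m2 m1 (mirror m1 u) k"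

text \<open>Continuation by continuity through a vertex v: a points from v along the side
preceding v (in the fixed orientation), b along the side following v. The trajectory
is the limit of trajectories hitting the preceding side near v (the side "to the left"
w.r.t. the orientation); if the trajectory arrives along that side, the approximating
trajectories first hit the other side. The outgoing direction is obtained after the
finitely many reflections near the corner, i.e. when the direction first lies in the
cone spanned by the two sides.\<close>
definition corner_exit :: "complex \<Rightarrow> complex \<Rightarrow> complex \<Rightarrow> complex" where
  "corner_exit a b u =
     (let (m1, m2) = (if \<exists>c>0. u = - (of_real c * a) then (b, a) else (a, b));
          k = (LEAST k. in_cone a b (corner_iter m1 m2 u k))
      in corner_iter m1 m2 u k)"

definition bounce :: "complex list \<Rightarrow> complex \<Rightarrow> complex \<Rightarrow> complex" where
  "bounce vs h u =
     (if \<exists>i<length vs. h = vtx vs i then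
        (let i = (SOME i. i < length vs \<and> h = vtx vs i)
         in corner_exit (vtx vs (i + length vs - 1) - vtx vs i) (vtx vs (Suc i) - vtx vs i) u)
      else
        (let i = (SOME i. i < length vs \<and> h \<in> side vs i)
         in mirror (side_dir vs i) u))"

definition billiard_step :: "complex list \<Rightarrow> complex \<times> complex \<Rightarrow> complex \<times> complex" where
  "billiard_step vs s =
     (let p = fst s; u = snd s;
          h = p + of_real (flight_time (poly_region vs) p u) * u
      in (h, bounce vs h u))"

definition collision :: "complex list \<Rightarrow> complex \<Rightarrow> complex \<Rightarrow> nat \<Rightarrow> complex \<times> complex" where
  "collision vs p u k = (billiard_step vs ^^ k) (p, u)"

definition collision_time :: "complex list \<Rightarrow> complex \<Rightarrow> complex \<Rightarrow> nat \<Rightarrow> real" where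
  "collision_time vs p u k =
     (\<Sum>j<k. flight_time (poly_region vs) (fst (collision vs p u j)) (snd (collision vs p u j)))"

definition flow_at :: "complex list \<Rightarrow> complex \<Rightarrow> complex \<Rightarrow> real \<Rightarrow> complex \<times> complex \<Rightarrow> bool" where
  "flow_at vs p u T st \<longleftrightarrow>
     (\<exists>k s. 0 \<le> s \<and> s < flight_time (poly_region vs) (fst (collision vs p u k)) (snd (collision vs p u k))
        \<and> T = collision_time vs p u k + s
        \<and> st = (fst (collision vs p u k) + of_real s * snd (collision vs p u k), snd (collision vs p u k)))"

definition billiard_periodic :: "complex list \<Rightarrow> complex \<Rightarrow> complex \<Rightarrow> bool" where
  "billiard_periodic vs q \<phi> \<longleftrightarrow> (\<exists>T>0. flow_at vs q \<phi> T (q, \<phi>))"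

end

theory Submission
  imports Defs
begin

text \<open>Launch the billiard ball perpendicularly from a side. The velocities on such a trajectory form a
finite set, by rationality. If the trajectory comes back to its side perpendicularly, time reversal
makes it retrace itself, so it is periodic. If it never comes back and never hits a vertex, then a
whole strip of parallel trajectories around it runs along forever; the traces of the strip on the
boundary do not shrink, so two of them overlap, and injectivity of the collision map turns the
overlap into a return. Hence only feet whose trajectory hits a vertex before returning are bad, and
each of them is determined by that vertex and the velocity of arrival, so they are finite in number.

In a convex polygon the nearest boundary point of an interior point is the foot of a perpendicular
on a side, hence all points of \<open>B\<close> lie on finitely many chords. In a triangle every point has
feet on two different sides, hence lies on two non-parallel chords.\<close>

subsection \<open>Plane geometry\<close>

text \<open>Rationality enters through reflections: a mirror multiplies by the squared direction of
  a side, a root of unity up to one fixed factor, which confines all velocities to finitely many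
  values. States are recorded just after a collision, strictly inside a side and pointing inward,
  where \<open>bounce\<close> is a single reflection. On such states time reversal turns
  \<open>step\<close> into its inverse, and a perpendicular state is its own reversal. An overlap of
  two traces yields a return only if both lie on the same side and carry the same velocity; the
  pigeonhole principle provides this. The width of the strip can be fixed in advance for all times
  because exceptional feet are finite in number. The delicate point is that a nonexceptional
  neighbour avoids vertices only as long as it has not returned, so absence of returns must be
  passed from the central trajectory to the whole strip. The region is defined by
  \<open>inside\<close>, and topology directly gives only that its frontier lies in the polygon.
  Sides are therefore handled through the property of supporting \<open>K\<close>
  (\<open>active\<close>).\<close>

lemma perp_eq_scaled_normal:
  fixes d w :: complex
  assumes "d \<noteq> 0" "w \<bullet> d = 0"
  shows "w = of_real (w \<bullet> (\<i> * sgn d)) * (\<i> * sgn d)"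
proof -
  define e where "e = sgn d"
  have e: "norm e = 1" "d = of_real (norm d) * e"
    using assms(1) by (simp_all add: e_def norm_sgn) (simp add: sgn_eq)
  have e2: "Re e * Re e + Im e * Im e = 1"
    using e(1) by (metis cmod_power2 one_power2 power2_eq_square)
  have "norm d * (w \<bullet> e) = 0"
    using assms(2) by (metis e(2) inner_scaleR_right scaleR_conv_of_real)
  then have we: "Re w * Re e + Im w * Im e = 0"
    using assms(1) by (simp add: inner_complex_def)
  have "Re w = - (Im w * Re e - Re w * Im e) * Im e" "Im w = (Im w * Re e - Re w * Im e) * Re e"
    using e2 we by algebra+
  then show ?thesis
    unfolding e_def [symmetric] by (simp add: complex_eq_iff inner_complex_def algebra_simps)
qed

lemma mirror_mirror [simp]: "d \<noteq> 0 \<Longrightarrow> mirror d (mirror d z) = z"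
proof -
  assume "d \<noteq> 0"
  then have "sgn d * cnj (sgn d) = 1"
    by (simp add: complex_norm_square [symmetric] norm_sgn)
  then have "(sgn d * cnj (sgn d))\<^sup>2 * z = z" by simp
  then show ?thesis
    by (simp add: mirror_def power_mult_distrib mult_ac)
qed

lemma norm_mirror [simp]: "d \<noteq> 0 \<Longrightarrow> norm (mirror d z) = norm z"
  by (simp add: mirror_def norm_mult norm_power norm_sgn)

lemma mirror_minus: "mirror d (- z) = - mirror d z"
  by (simp add: mirror_def)

lemma inner_mirror:
  assumes "d \<noteq> 0" and w: "w = \<i> * sgn d \<or> w = - (\<i> * sgn d)"
  shows "mirror d z \<bullet> w = - (z \<bullet> w)"
proof -
  obtain x y where xy: "sgn d = Complex x y" by (cases "sgn d")
  have "x * x + y * y = 1"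
    using assms(1) norm_sgn[of d] by (simp add: xy cmod_def power2_eq_square)
  then have "mirror d z \<bullet> (\<i> * sgn d) = - (z \<bullet> (\<i> * sgn d))"
    unfolding mirror_def xy by (simp add: inner_complex_def power2_eq_square) algebra
  then show ?thesis using w by auto
qed

lemma mirror_normal:
  assumes "d \<noteq> 0" and w: "w = \<i> * sgn d \<or> w = - (\<i> * sgn d)"
  shows "mirror d w = - w"
proof -
  have "sgn d * cnj (sgn d) = 1"
    using assms(1) by (simp add: complex_norm_square [symmetric] norm_sgn)
  then have "mirror d (\<i> * sgn d) = - (\<i> * sgn d)"
    by (simp add: mirror_def power2_eq_square mult.assoc)
  then show ?thesis using w by (auto simp: mirror_minus)
qed

text \<open>The reflection fixes \<open>w\<close>, which runs along the mirror, and reverses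
  orientation.\<close>

lemma mirror_cross:
  assumes "d \<noteq> 0" "w = of_real c * sgn d"
  shows "Im (cnj (mirror d z) * w) = - Im (cnj z * w)"
proof -
  obtain x y where xy: "sgn d = Complex x y" by (cases "sgn d")
  have "x * x + y * y = 1"
    using assms(1) norm_sgn[of d] by (simp add: xy cmod_def power2_eq_square)
  then show ?thesis
    unfolding assms(2) mirror_def xy by (simp add: power2_eq_square) algebra
qed

text \<open>The vectors \<open>a - p\<close> and \<open>b - p\<close> are multiples of
  \<open>b - a\<close> of opposite sign, so a functional that is nonnegative on both vanishes on
  \<open>b - a\<close>.\<close>

lemma supporting_perp:
  fixes a b p w :: "'a::real_inner"
  assumes "p \<in> open_segment a b" "(a - p) \<bullet> w \<ge> 0" "(b - p) \<bullet> w \<ge> 0"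
  shows "w \<bullet> (b - a) = 0"
proof -
  obtain l where l: "0 < l" "l < 1" "p = (1 - l) *\<^sub>R a + l *\<^sub>R b"
    using assms(1) by (auto simp: in_segment)
  have "a - p = (- l) *\<^sub>R (b - a)" "b - p = (1 - l) *\<^sub>R (b - a)"
    by (simp_all add: l(3) algebra_simps)
  then have "- l * ((b - a) \<bullet> w) \<ge> 0" "(1 - l) * ((b - a) \<bullet> w) \<ge> 0"
    using assms(2,3) by (metis inner_scaleR_left)+
  then show ?thesis
    using l(1,2) by (simp add: zero_le_mult_iff mult_le_0_iff inner_commute)
qed

text \<open>The hypothesis puts the foot of \<open>q\<close> on the line \<open>ab\<close> beyond
  \<open>b\<close>. This forces an obtuse angle at \<open>b\<close>, and then the feet on the two
  other sides cannot miss them.\<close>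

lemma obtuse_feet:
  fixes a b c q :: "'a::real_inner"
  assumes "q \<in> convex hull {a, b, c}" "(q - b) \<bullet> (a - b) < 0"
  shows "0 \<le> (q - b) \<bullet> (c - b)" "0 \<le> (q - c) \<bullet> (b - c)" "0 \<le> (q - a) \<bullet> (c - a)" "0 \<le> (q - c) \<bullet> (a - c)"
proof -
  obtain u v w where uvw: "0 \<le> u" "0 \<le> v" "0 \<le> w" "u + v + w = 1" "q = u *\<^sub>R a + v *\<^sub>R b + w *\<^sub>R c"
    using assms(1) by (auto simp: convex_hull_3)
  define A C where "A = a - b" and "C = c - b"
  have v: "v = 1 - u - w" using uvw(4) by simp
  have qb: "q - b = u *\<^sub>R A + w *\<^sub>R C"
    unfolding uvw(5) v by (simp add: A_def C_def algebra_simps)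
  have qa: "q - a = (u - 1) *\<^sub>R A + w *\<^sub>R C" and qc: "q - c = u *\<^sub>R A + (w - 1) *\<^sub>R C"
    unfolding uvw(5) v by (simp_all add: A_def C_def algebra_simps)
  have ca: "c - a = C - A" "a - c = A - C" "b - c = - C" by (simp_all add: A_def C_def)
  have neg: "u * (A \<bullet> A) + w * (A \<bullet> C) < 0"
    using assms(2) unfolding qb A_def [symmetric]
    by (simp add: inner_add_left inner_add_right inner_commute[of C A])
  have nonneg: "0 \<le> A \<bullet> A" "0 \<le> C \<bullet> C" by simp_all
  then have "w * (A \<bullet> C) < 0" using neg uvw(1) mult_nonneg_nonneg[of u "A \<bullet> A"] by linarith
  then have AC: "A \<bullet> C < 0" using uvw(3) by (simp add: mult_less_0_iff)
  have CS: "(A \<bullet> C)\<^sup>2 \<le> (A \<bullet> A) * (C \<bullet> C)" by (rule Cauchy_Schwarz_ineq)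
  have "A \<noteq> 0" using AC by auto
  then have AA: "0 < A \<bullet> A" by simp
  \<comment> \<open>Scaling by \<open>A \<bullet> A\<close> makes the negative quantity
    \<open>neg\<close> appear; what remains is \<open>w\<close> times a Gram determinant,
    nonnegative by Cauchy-Schwarz.\<close>
  have "(A \<bullet> A) * (u * (A \<bullet> C) + w * (C \<bullet> C)) = (A \<bullet> C) * (u * (A \<bullet> A) + w * (A \<bullet> C)) + w * ((A \<bullet> A) * (C \<bullet> C) - (A \<bullet> C)\<^sup>2)"
    by (simp add: algebra_simps power2_eq_square)
  also have "\<dots> \<ge> 0"
    using AC neg CS uvw(3) by (intro add_nonneg_nonneg mult_nonpos_nonpos mult_nonneg_nonneg) auto
  finally have "0 \<le> u * (A \<bullet> C) + w * (C \<bullet> C)" using AA by (simp add: zero_le_mult_iff)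
  then show "0 \<le> (q - b) \<bullet> (c - b)" unfolding qb C_def [symmetric] by (simp add: inner_add_left)
  have uw: "u \<le> 1" "w \<le> 1" using uvw by linarith+
  have p: "0 \<le> - (u * (A \<bullet> C))" "0 \<le> - (w * (A \<bullet> C))" "0 \<le> - ((1 - u) * (A \<bullet> C))" "0 \<le> - ((1 - w) * (A \<bullet> C))"
    "0 \<le> u * (A \<bullet> A)" "0 \<le> (1 - u) * (A \<bullet> A)" "0 \<le> w * (C \<bullet> C)" "0 \<le> (1 - w) * (C \<bullet> C)"
    using AC uvw uw nonneg by (auto simp: mult_nonneg_nonpos)
  have e: "(q - c) \<bullet> (b - c) = - (u * (A \<bullet> C)) + (1 - w) * (C \<bullet> C)"
    "(q - a) \<bullet> (c - a) = - ((1 - u) * (A \<bullet> C)) + (1 - u) * (A \<bullet> A) + w * (C \<bullet> C) - w * (A \<bullet> C)"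
    "(q - c) \<bullet> (a - c) = u * (A \<bullet> A) - u * (A \<bullet> C) - (1 - w) * (A \<bullet> C) + (1 - w) * (C \<bullet> C)"
    unfolding qa qc ca by (simp_all add: inner_simps inner_commute[of C A] algebra_simps)
  show "0 \<le> (q - c) \<bullet> (b - c)" "0 \<le> (q - a) \<bullet> (c - a)" "0 \<le> (q - c) \<bullet> (a - c)"
    unfolding e using p by linarith+
qed

definition foot_within :: "complex \<Rightarrow> complex \<Rightarrow> complex \<Rightarrow> bool" where
  "foot_within q a b \<longleftrightarrow> 0 \<le> (q - a) \<bullet> (b - a) \<and> 0 \<le> (q - b) \<bullet> (a - b)"

lemma triangle_foot_or_feet:
  assumes "q \<in> convex hull {a, b, c}"
  shows "foot_within q a b \<or> foot_within q b c \<and> foot_within q c a"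
proof (rule ccontr)
  assume not: "\<not> ?thesis"
  have "{a, b, c} = {b, a, c}" by auto
  with assms have "q \<in> convex hull {b, a, c}" by metis
  from obtuse_feet[OF this] obtuse_feet[OF assms] have
    "\<not> (q - b) \<bullet> (a - b) < 0" "\<not> (q - a) \<bullet> (b - a) < 0"
    using not unfolding foot_within_def by blast+
  then show False using not by (simp add: foot_within_def not_less)
qed

text \<open>Applied to each side in turn, the previous lemma lets at most one foot miss its side.
  Each pair is listed as a side and its cyclic successor, the form in which non-parallel normals are
  available.\<close>

lemma triangle_two_feet:
  assumes "q \<in> convex hull {a, b, c}"
  shows "foot_within q a b \<and> foot_within q b c \<or> foot_within q b c \<and> foot_within q c a \<or> foot_within q c a \<and> foot_within q a b"
proof -
  have "{a, b, c} = {b, c, a}" "{a, b, c} = {c, a, b}" by auto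
  with assms have "q \<in> convex hull {b, c, a}" "q \<in> convex hull {c, a, b}" by metis+
  from this[THEN triangle_foot_or_feet] triangle_foot_or_feet[OF assms] show ?thesis by blast
qed

text \<open>The difference of two common points is a multiple of both \<open>u\<close> and
  \<open>v\<close>; multiplying by \<open>cnj u\<close> and taking imaginary parts kills the
  \<open>u\<close> side and leaves \<open>t = t'\<close>.\<close>

lemma finite_line_inter:
  assumes "Im (cnj u * v) \<noteq> 0"
  shows "finite ({x + of_real s * u | s. True} \<inter> {y + of_real t * v | t. True})" (is "finite ?L")
proof -
  have "p = p'" if p: "p \<in> ?L" "p' \<in> ?L" for p p'
  proof -
    obtain s s' t t' where e: "p = x + of_real s * u" "p = y + of_real t * v"
      "p' = x + of_real s' * u" "p' = y + of_real t' * v" using p by blast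
    then have "(x + of_real s * u) - (x + of_real s' * u) = (y + of_real t * v) - (y + of_real t' * v)" by metis
    then have "(s - s') *\<^sub>R u = (t - t') *\<^sub>R v" by (simp add: scaleR_conv_of_real algebra_simps)
    then have "cnj u * ((s - s') *\<^sub>R u) = cnj u * ((t - t') *\<^sub>R v)" by simp
    then have "(s - s') *\<^sub>R (cnj u * u) = (t - t') *\<^sub>R (cnj u * v)" by simp
    then have "(s - s') * Im (cnj u * u) = (t - t') * Im (cnj u * v)" by (metis scaleR_complex.sel(2))
    then have "0 = (t - t') * Im (cnj u * v)" by simp
    then have "t = t'" using assms by simp
    then show ?thesis using e(2,4) by simp
  qed
  then have "?L = {} \<or> (\<exists>p. ?L = {p})" by blast
  then show ?thesis by (elim disjE exE) (simp_all only: finite.emptyI finite_insert)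
qed

lemma infinite_close:
  fixes p :: "nat \<Rightarrow> 'a::metric_space"
  assumes "infinite A" "compact S" "\<And>k. k \<in> A \<Longrightarrow> p k \<in> S" "\<epsilon> > 0"
  obtains k l where "k \<in> A" "l \<in> A" "k < l" "dist (p k) (p l) < \<epsilon>"
proof -
  have "\<forall>n. (p \<circ> enumerate A) n \<in> S" using enumerate_in_set[OF assms(1)] assms(3) by simp
  then obtain r q where r: "strict_mono (r :: nat \<Rightarrow> nat)" "((p \<circ> enumerate A) \<circ> r) \<longlonglongrightarrow> q"
    using assms(2) unfolding compact_def by metis
  then have "Cauchy ((p \<circ> enumerate A) \<circ> r)" by (blast intro: LIMSEQ_imp_Cauchy)
  then obtain N where "\<forall>m\<ge>N. \<forall>n\<ge>N. dist (((p \<circ> enumerate A) \<circ> r) m) (((p \<circ> enumerate A) \<circ> r) n) < \<epsilon>"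
    using assms(4) unfolding Cauchy_def by blast
  then have "dist (p (enumerate A (r N))) (p (enumerate A (r (Suc N)))) < \<epsilon>" by simp
  moreover have "enumerate A (r N) < enumerate A (r (Suc N))"
    using r(1) enumerate_mono[OF _ assms(1)] by (simp add: strict_mono_less)
  ultimately show ?thesis using that enumerate_in_set[OF assms(1)] by blast
qed

text \<open>The angle is doubled because \<open>mirror\<close> uses the square of the direction of a
  side.\<close>

lemma rational_angle_power:
  assumes "\<theta> / pi \<in> \<rat>"
  shows "\<exists>m>0. cis (2 * \<theta>) ^ m = 1"
proof -
  obtain a :: int and b :: nat where ab: "\<theta> / pi = of_int a / of_nat b" "b \<noteq> 0"
    using assms by (auto simp: Rats_eq_int_div_nat)
  have "real b * (2 * \<theta>) = 2 * pi * of_int a"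
    using ab by (simp add: field_simps)
  then have "cis (2 * \<theta>) ^ b = 1"
    by (simp only: Complex.DeMoivre cis_multiple_2pi Ints_of_int)
  then show ?thesis using ab(2) by blast
qed

subsection \<open>Convex polygons and their supporting sides\<close>

locale convex_polygon =  fixes vs :: "complex list"
  assumes simple: "simple_polygon vs"
    and convex_region: "convex (poly_region vs)"
begin

abbreviation "K \<equiv> poly_region vs"

lemma length_ge: "3 \<le> length vs"
  and corner: "i < length vs \<Longrightarrow> Im (cnj (side_dir vs i) * side_dir vs (Suc i)) \<noteq> 0"
  using simple by (auto simp: simple_polygon_def)

lemma vtx_in: "vtx vs i \<in> set vs"
  using length_ge by (auto simp: vtx_def intro!: nth_mem mod_less_divisor)

lemma ex_vtx_iff: "(\<exists>i<length vs. h = vtx vs i) \<longleftrightarrow> h \<in> set vs"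
  by (auto simp: in_set_conv_nth vtx_def) 

lemma side_dir_nz: "i < length vs \<Longrightarrow> side_dir vs i \<noteq> 0"
  using corner by fastforce

lemma side_open:
  assumes "p \<in> side vs i" "p \<notin> set vs"
  shows "p \<in> open_segment (vtx vs i) (vtx vs (Suc i))"
  using assms vtx_in by (auto simp: side_def open_segment_def)

lemma side_unique:
  assumes "i < length vs" "j < length vs" "p \<in> side vs i" "p \<in> side vs j" "p \<notin> set vs"
  shows "i = j"
proof (rule ccontr)
  assume "i \<noteq> j"
  then have "if j = Suc i mod length vs then side vs i \<inter> side vs j = {vtx vs (Suc i)}
         else if i = Suc j mod length vs then side vs i \<inter> side vs j = {vtx vs i}
         else side vs i \<inter> side vs j = {}"
    using simple assms by (simp add: simple_polygon_def)
  then show False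
    using assms vtx_in by (metis Int_iff empty_iff singletonD)
qed

lemma compact_boundary: "compact (poly_boundary vs)"
  unfolding poly_boundary_def side_def by (intro compact_UN) auto

lemma compact_region: "compact K"
proof -
  have "closed K"
    unfolding poly_region_def union_with_inside
    using open_outside compact_boundary compact_imp_closed by blast
  moreover have "bounded K"
    unfolding poly_region_def using compact_boundary bounded_inside compact_imp_bounded by auto
  ultimately show ?thesis using compact_eq_bounded_closed by blast
qed

lemma closed_region: "closed K"
  using compact_region compact_imp_closed by blast

lemma side_subset: "i < length vs \<Longrightarrow> side vs i \<subseteq> K"
  unfolding poly_region_def poly_boundary_def by auto

lemma vtx_region: "vtx vs i \<in> K"
proof -
  obtain j where "j < length vs" "vtx vs i = vtx vs j"
    using vtx_in[of i] ex_vtx_iff by blast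
  then show ?thesis using side_subset[of j] by (auto simp: side_def)
qed

lemma frontier_region: "frontier K \<subseteq> poly_boundary vs"
proof -
  have "inside (poly_boundary vs) \<subseteq> interior K"
    using open_inside[OF compact_imp_closed[OF compact_boundary]]
    by (intro interior_maximal) (auto simp: poly_region_def)
  then show ?thesis
    using closure_closed[OF closed_region] unfolding frontier_def by (auto simp: poly_region_def)
qed

text \<open>Otherwise the convex set \<open>K\<close> would lie on a line, whose normal
  \<open>a\<close> would be orthogonal to two consecutive, linearly independent side
  directions.\<close>

lemma interior_nonempty: "interior K \<noteq> {}"
proof
  assume "interior K = {}"
  then obtain a b where a: "a \<noteq> 0" "K \<subseteq> {x. a \<bullet> x = b}"
    using empty_interior_subset_hyperplane[OF convex_region] by blast
  have "a \<bullet> vtx vs i = b" for i using a(2) vtx_region by auto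
  then have d: "a \<bullet> side_dir vs 0 = 0" "a \<bullet> side_dir vs (Suc 0) = 0"
    by (auto simp: side_dir_def inner_diff_right)
  have "Im (cnj (side_dir vs 0) * side_dir vs (Suc 0)) * (Re a * Re a + Im a * Im a) = 0"
    using d by (simp add: inner_complex_def) algebra
  moreover have "Re a * Re a + Im a * Im a \<noteq> 0"
    using a(1) by (simp add: complex_eq_iff sum_squares_eq_zero_iff)
  moreover have "0 < length vs" using length_ge by linarith
  ultimately show False using corner[of 0] by simp
qed

text \<open>The inward unit normal is selected by testing against \<open>K\<close>, since the
  vertices may be listed in either orientation. Even when neither choice points inward, the value is
  a unit normal.\<close>

definition nrm :: "nat \<Rightarrow> complex" where
  "nrm i = (if \<forall>z\<in>K. 0 \<le> (z - vtx vs i) \<bullet> (\<i> * sgn (side_dir vs i))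
            then \<i> * sgn (side_dir vs i) else - (\<i> * sgn (side_dir vs i)))"

text \<open>The line of an active side supports \<open>K\<close>. The two lemmas on frontier points
  supply such sides wherever a trajectory starts or ends.\<close>

definition active :: "nat \<Rightarrow> bool" where
  "active i \<longleftrightarrow> i < length vs \<and> (\<forall>z\<in>K. 0 \<le> (z - vtx vs i) \<bullet> nrm i)"

lemma nrm_cases: "nrm i = \<i> * sgn (side_dir vs i) \<or> nrm i = - (\<i> * sgn (side_dir vs i))"
  by (simp add: nrm_def)

lemma norm_nrm: "i < length vs \<Longrightarrow> norm (nrm i) = 1"
  using nrm_cases[of i] side_dir_nz by (auto simp: norm_mult norm_sgn)

lemma nrm_perp: "side_dir vs i \<bullet> nrm i = 0"
  using nrm_cases[of i] by (auto simp: sgn_eq inner_complex_def)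

lemma along_side:
  assumes "i < length vs" "v \<bullet> nrm i = 0"
  obtains c where "v = of_real c * sgn (side_dir vs i)"
proof -
  have "nrm i \<noteq> 0" "sgn (nrm i) = nrm i" using norm_nrm[OF assms(1)] by (auto simp: sgn_div_norm)
  then obtain c where c: "v = of_real c * (\<i> * nrm i)"
    using perp_eq_scaled_normal[OF _ assms(2)] by metis
  have "v = of_real (- c) * sgn (side_dir vs i) \<or> v = of_real c * sgn (side_dir vs i)"
    using nrm_cases[of i] by (auto simp: c)
  then show ?thesis using that by blast
qed

lemma on_side:
  assumes "p \<in> side vs i" shows "(z - vtx vs i) \<bullet> nrm i = (z - p) \<bullet> nrm i"
proof -
  obtain l where "p = (1 - l) *\<^sub>R vtx vs i + l *\<^sub>R vtx vs (Suc i)"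
    using assms by (auto simp: side_def in_segment)
  then have "p - vtx vs i = l *\<^sub>R side_dir vs i" by (simp add: side_dir_def algebra_simps)
  then have "(p - vtx vs i) \<bullet> nrm i = 0" by (simp add: nrm_perp)
  then show ?thesis by (simp add: inner_diff_left)
qed

lemma active_support: "active i \<Longrightarrow> p \<in> side vs i \<Longrightarrow> z \<in> K \<Longrightarrow> 0 \<le> (z - p) \<bullet> nrm i"
  using on_side by (auto simp: active_def)

text \<open>A supporting line at \<open>p\<close> must contain the whole side, because
  \<open>p\<close> is a relative interior point of it. Hence its normal \<open>a\<close> is a
  multiple of the unit normal, and the sign of the factor \<open>c\<close> tells on which side
  \<open>K\<close> lies.\<close>

lemma frontier_nonvertex:
  assumes "p \<in> frontier K" "p \<notin> set vs"
  obtains i where "active i" "p \<in> side vs i"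
proof -
  obtain i where i: "i < length vs" "p \<in> side vs i"
    using frontier_region assms(1) by (auto simp: poly_boundary_def)
  have pK: "p \<in> K" "p \<notin> interior K"
    using assms(1) closed_region by (auto simp: frontier_def)
  then have "p \<notin> rel_interior K"
    using interior_nonempty by (simp add: interior_rel_interior_gen split: if_splits)
  then obtain a where a: "a \<noteq> 0" "\<And>y. y \<in> K \<Longrightarrow> a \<bullet> p \<le> a \<bullet> y"
    using supporting_hyperplane_rel_boundary[OF convex_region pK(1)] by metis
  have "a \<bullet> (vtx vs (Suc i) - vtx vs i) = 0"
    using a(2) vtx_region
    by (intro supporting_perp[OF side_open[OF i(2) assms(2)]])
      (auto simp: inner_diff_right inner_commute[of _ a])
  then have "a \<bullet> side_dir vs i = 0" by (simp add: side_dir_def)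
  define w where "w = \<i> * sgn (side_dir vs i)"
  define c where "c = a \<bullet> w"
  have ac: "a = of_real c * w"
    using perp_eq_scaled_normal[OF side_dir_nz[OF i(1)] \<open>a \<bullet> side_dir vs i = 0\<close>] by (simp add: c_def w_def)
  have c: "c * ((y - p) \<bullet> w) \<ge> 0" if "y \<in> K" for y
    using a(2)[OF that] unfolding ac
    by (metis diff_ge_0_iff_ge inner_commute inner_diff_right inner_scaleR_left scaleR_conv_of_real)
  have pw: "(y - vtx vs i) \<bullet> w = (y - p) \<bullet> w" for y
    using on_side[OF i(2), of y] nrm_cases[of i] by (auto simp: w_def)
  have "c \<noteq> 0" using a(1) ac by auto
  have "active i"
  proof (cases "\<forall>z\<in>K. 0 \<le> (z - vtx vs i) \<bullet> w")
    case True
    then show ?thesis using i by (simp add: active_def nrm_def w_def)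
  next
    case False
    then have "c < 0" using c pw \<open>c \<noteq> 0\<close>
      by (metis linorder_neqE_linordered_idom zero_le_mult_iff leD)
    then have "\<forall>z\<in>K. (z - vtx vs i) \<bullet> w \<le> 0"
      using c pw by (metis zero_le_mult_iff leD)
    moreover have "nrm i = - w" using False unfolding nrm_def w_def by (rule if_not_P)
    ultimately show ?thesis using i by (simp add: active_def)
  qed
  then show ?thesis using i that by blast
qed

text \<open>For vertices this holds because the frontier has no isolated point: a small punctured disc is
connected and meets both the interior and the exterior.\<close>

lemma frontier_active:
  assumes "x \<in> frontier K"
  obtains i where "active i" "x \<in> side vs i"
proof (rule ccontr)
  assume "\<not> thesis"
  define A where "A = (\<Union>i\<in>{i. active i}. side vs i)"
  have "finite {i. active i}" by (rule finite_subset[of _ "{..<length vs}"]) (auto simp: active_def)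
  then have "closed A" unfolding A_def side_def by (intro closed_UN) auto
  moreover have "x \<notin> A" using \<open>\<not> thesis\<close> that by (auto simp: A_def)
  moreover have "closed (set vs - {x})" by (simp add: finite_imp_closed)
  ultimately have "open (- (A \<union> (set vs - {x})))" "x \<in> - (A \<union> (set vs - {x}))"
    by (simp_all only: open_Compl closed_Un) simp
  then obtain e where e: "e > 0" "ball x e \<subseteq> - (A \<union> (set vs - {x}))"
    by (meson open_contains_ball)
  have fr: "frontier K \<inter> ball x e \<subseteq> {x}"
  proof
    fix y assume y: "y \<in> frontier K \<inter> ball x e"
    then have "y \<notin> A" using e(2) by auto
    then have "\<not> (active i \<and> y \<in> side vs i)" for i by (auto simp: A_def)
    then have "y \<in> set vs"
      using y frontier_nonvertex by (metis IntD1)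
    then show "y \<in> {x}" using y e(2) by auto
  qed
  let ?P = "ball x e - {x}"
  have conn: "connected ?P" by (rule connected_punctured_ball) auto
  have "x \<in> closure (interior K)" using assms convex_closure_interior[OF convex_region interior_nonempty]
    by (simp add: frontier_def)
  then obtain y where y: "y \<in> interior K" "dist y x < e"
    using e(1) closure_approachable by blast
  have xi: "x \<notin> interior K" using assms by (simp add: frontier_def)
  then have "y \<in> ?P \<inter> K"
    using y interior_subset[of K] by (auto simp: dist_commute)
  then have "?P \<inter> K \<noteq> {}" by blast
  moreover have "?P - K \<noteq> {}"
  proof -
    have "x \<in> K" using assms closed_region by (auto simp: frontier_def)
    have "\<not> ball x e \<subseteq> K" using xi e(1) mem_interior by blast
    then show ?thesis using \<open>x \<in> K\<close> by auto
  qed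
  ultimately have "?P \<inter> frontier K \<noteq> {}" using conn by (intro connected_Int_frontier)
  then show False using fr by auto
qed

text \<open>The foot may be an endpoint of the side; these are absorbed by the finitely many vertices.\<close>

lemma foot:
  assumes "q \<in> interior K"
  obtains i x s where "active i" "x \<in> side vs i" "s \<ge> 0" "q = x + of_real s * nrm i"
proof -
  have "frontier K \<noteq> {}"
    using compact_region interior_nonempty by (metis compact_imp_bounded frontier_eq_empty interior_empty not_bounded_UNIV)
  then obtain x where x: "x \<in> frontier K" "\<And>y. y \<in> frontier K \<Longrightarrow> dist q x \<le> dist q y"
    using distance_attains_inf[OF frontier_closed] by metis
  obtain i where i: "active i" "x \<in> side vs i" using frontier_active[OF x(1)] .
  have il: "i < length vs" using i by (simp add: active_def)
  define s where "s = norm (q - x)"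
  have ball: "ball q s \<subseteq> K"
  proof (rule ccontr)
    assume "\<not> ball q s \<subseteq> K"
    then have ne: "ball q s - K \<noteq> {}" by blast
    have "s > 0" using x(1) assms by (auto simp: s_def frontier_def)
    then have "q \<in> ball q s" by simp
    moreover have "q \<in> K" using assms interior_subset by blast
    ultimately have "ball q s \<inter> K \<noteq> {}" by blast
    then have "ball q s \<inter> frontier K \<noteq> {}" using ne connected_ball by (intro connected_Int_frontier)
    then obtain y where "y \<in> ball q s" "y \<in> frontier K" by blast
    then show False using x(2)[of y] by (simp add: s_def dist_norm)
  qed
  \<comment> \<open>Every point \<open>q - r nrm i\<close> with \<open>0 \<le> r < s\<close> lies in
    the disc, hence in \<open>K\<close>, hence at nonnegative height over the side. So the height of
    \<open>q\<close> is at least its distance to \<open>x\<close>, and equality in Cauchy-Schwarz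
    makes \<open>q - x\<close> a multiple of the normal.\<close>
  have "s \<le> (q - x) \<bullet> nrm i"
  proof (rule dense_le)
    fix r assume "r < s"
    show "r \<le> (q - x) \<bullet> nrm i"
    proof (cases "r < 0")
      case True
      moreover have "0 \<le> (q - x) \<bullet> nrm i" using active_support[OF i] assms interior_subset by blast
      ultimately show ?thesis by simp
    next
      case False
      have "q - of_real r * nrm i \<in> K"
        using \<open>r < s\<close> False norm_nrm[OF il] by (intro subsetD[OF ball]) (simp add: dist_norm norm_mult)
      from active_support[OF i this] have "0 \<le> (q - x) \<bullet> nrm i - (r *\<^sub>R nrm i) \<bullet> nrm i"
        by (simp add: inner_diff_left scaleR_conv_of_real)
      then show ?thesis using norm_nrm[OF il] by (simp add: dot_square_norm)
    qed
  qed
  moreover have "(q - x) \<bullet> nrm i \<le> s"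
    using norm_cauchy_schwarz[of "q - x" "nrm i"] norm_nrm[OF il] by (simp add: s_def)
  ultimately have "(q - x) \<bullet> nrm i = norm (q - x) * norm (nrm i)"
    using norm_nrm[OF il] by (simp add: s_def)
  then have "norm (q - x) *\<^sub>R nrm i = norm (nrm i) *\<^sub>R (q - x)"
    using norm_cauchy_schwarz_eq by blast
  then have "s *\<^sub>R nrm i = q - x"
    unfolding s_def [symmetric] norm_nrm[OF il] by simp
  then have "q = x + of_real s * nrm i"
    by (metis add.commute diff_add_cancel scaleR_conv_of_real)
  moreover have "s \<ge> 0" by (simp add: s_def)
  ultimately show ?thesis using i that by blast
qed

subsection \<open>The collision map and time reversal\<close>

text \<open>Convexity reduces the condition on segments to one on endpoints, so the admissible times
  form a closed bounded set and the supremum is attained.\<close>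

lemma flight:
  assumes "p \<in> K" "norm u = 1"
  shows flight_nonneg: "0 \<le> flight_time K p u"
    and flight_end: "p + of_real (flight_time K p u) * u \<in> K"
    and flight_max: "\<And>t. 0 \<le> t \<Longrightarrow> p + of_real t * u \<in> K \<Longrightarrow> t \<le> flight_time K p u"
proof -
  define F where "F = {t. t \<ge> 0 \<and> p + of_real t * u \<in> K}"
  have seg: "closed_segment p z \<subseteq> K \<longleftrightarrow> z \<in> K" for z
    by (meson closed_segment_subset[OF assms(1) _ convex_region] ends_in_segment(2) subsetD)
  have fl: "flight_time K p u = Sup F"
    by (simp add: flight_time_def F_def seg)
  have "F = {0..} \<inter> (\<lambda>t. p + of_real t * u) -` K" by (auto simp: F_def)
  then have "closed F"
    by (auto intro!: closed_Int closed_vimage closed_region continuous_intros)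
  obtain b where b: "\<And>z. z \<in> K \<Longrightarrow> norm z \<le> b"
    using compact_region compact_imp_bounded bounded_iff by metis
  have le: "t \<le> b + norm p" if "t \<in> F" for t
  proof -
    have "t = norm ((p + of_real t * u) - p)" using that assms(2) by (simp add: F_def norm_mult)
    also have "\<dots> \<le> norm (p + of_real t * u) + norm p" by (rule norm_triangle_ineq4)
    finally show ?thesis using b that by (fastforce simp: F_def)
  qed
  have bdd: "bdd_above F" using le by (auto simp: bdd_above_def)
  have "0 \<in> F" using assms by (simp add: F_def)
  then have "Sup F \<in> F"
    using closed_contains_Sup[OF _ bdd \<open>closed F\<close>] by blast
  then show "0 \<le> flight_time K p u" "p + of_real (flight_time K p u) * u \<in> K"
    by (auto simp: fl F_def)
  show "t \<le> flight_time K p u" if "0 \<le> t" "p + of_real t * u \<in> K" for t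
    unfolding fl by (rule cSup_upper) (use that bdd in \<open>auto simp: F_def\<close>)
qed

lemma flight_eqI:
  assumes "p \<in> K" "norm u = 1" "0 \<le> t" "p + of_real t * u \<in> K"
    and "\<And>t'. t' > t \<Longrightarrow> p + of_real t' * u \<notin> K"
  shows "flight_time K p u = t"
  using assms flight_nonneg flight_end flight_max by (metis linorder_neqE_linordered_idom not_less)

text \<open>These are the states just after a collision away from the vertices: there
  \<open>bounce\<close> is one reflection, and the index \<open>i\<close> is determined by the
  position.\<close>

definition good :: "nat \<Rightarrow> complex \<times> complex \<Rightarrow> bool" where
  "good i s \<longleftrightarrow> active i \<and> fst s \<in> side vs i \<and> fst s \<notin> set vs \<and> norm (snd s) = 1 \<and> 0 < snd s \<bullet> nrm i"

lemma good_active: "good i s \<Longrightarrow> i < length vs"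
  by (auto simp: good_def active_def)

lemma good_region: "good i s \<Longrightarrow> fst s \<in> K"
  using good_active[of i s] side_subset[of i] by (auto simp: good_def)

lemma good_unique: "good i s \<Longrightarrow> fst s \<in> side vs j \<Longrightarrow> j < length vs \<Longrightarrow> i = j"
  using good_active side_unique by (auto simp: good_def)

lemma leave_region:
  assumes "active i" "p \<in> side vs i" "u \<bullet> nrm i < 0" "t > 0"
  shows "p + of_real t * u \<notin> K"
proof
  assume "p + of_real t * u \<in> K"
  from active_support[OF assms(1,2) this] have "0 \<le> t * (u \<bullet> nrm i)"
    by (simp flip: scaleR_conv_of_real)
  then show False using assms(3,4) by (simp add: zero_le_mult_iff)
qed

text \<open>For small \<open>e\<close> the point \<open>p + e u\<close> is a convex combination of a
  point of the side and a point \<open>z\<close> of \<open>K\<close> off the line of that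
  side.\<close>

lemma flight_pos:
  assumes "good i (p, u)"
  shows "0 < flight_time K p u"
proof -
  have i: "i < length vs" "active i" "p \<in> side vs i" "p \<notin> set vs" "norm u = 1" "0 < u \<bullet> nrm i"
    using assms good_active by (auto simp: good_def)
  define a b where "a = vtx vs i" and "b = vtx vs (Suc i)"
  define d where "d = side_dir vs i"
  have d: "d = b - a" "d \<noteq> 0" using side_dir_nz[OF i(1)] by (auto simp: d_def side_dir_def a_def b_def)
  obtain l where l: "0 < l" "l < 1" "p = (1 - l) *\<^sub>R a + l *\<^sub>R b"
    using side_open[OF i(3,4)] by (auto simp: in_segment a_def b_def)
  have nn: "nrm i \<bullet> nrm i = 1" using norm_nrm[OF i(1)] by (simp add: dot_square_norm)
  have par: "\<exists>c. w = c *\<^sub>R d" if w: "w \<bullet> nrm i = 0" for w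
  proof -
    obtain c where "w = of_real c * sgn d" using along_side[OF i(1) w] unfolding d_def .
    then have "w = (c / norm d) *\<^sub>R d" by (simp add: sgn_div_norm scaleR_conv_of_real divide_inverse)
    then show ?thesis by blast
  qed
  obtain z where z: "z \<in> K" "(z - p) \<bullet> nrm i > 0"
  proof -
    obtain y where "y \<in> interior K" using interior_nonempty by blast
    then obtain e where e: "e > 0" "cball y e \<subseteq> K" using mem_interior_cball by blast
    have y: "y \<in> K" using e by auto
    have "y + of_real e * nrm i \<in> K"
      using e norm_nrm[OF i(1)] by (intro subsetD[OF e(2)]) (simp add: dist_norm norm_mult)
    moreover have "(y + of_real e * nrm i - p) \<bullet> nrm i = (y - p) \<bullet> nrm i + e"
      using nn by (simp add: inner_diff_left inner_add_left flip: scaleR_conv_of_real)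
    ultimately show ?thesis
      using active_support[OF i(2,3) y] e(1) that by (metis add_nonneg_pos)
  qed
  \<comment> \<open>Matching normal components makes \<open>u - \<beta> (z - p)\<close> parallel to
    the side.\<close>
  define \<beta> where "\<beta> = (u \<bullet> nrm i) / ((z - p) \<bullet> nrm i)"
  have \<beta>: "\<beta> > 0" using z i(6) by (simp add: \<beta>_def)
  have "(u - \<beta> *\<^sub>R (z - p)) \<bullet> nrm i = 0"
    using z by (simp add: \<beta>_def inner_diff_left)
  then obtain c where "u - \<beta> *\<^sub>R (z - p) = c *\<^sub>R d" using par by blast
  then have c: "u = c *\<^sub>R d + \<beta> *\<^sub>R (z - p)" by (simp add: algebra_simps)
  have "((\<lambda>e. l + e * c / (1 - e * \<beta>)) \<longlongrightarrow> l + 0 * c / (1 - 0 * \<beta>)) (at_right 0)"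
    by (intro tendsto_intros) auto
  then have l1: "((\<lambda>e. l + e * c / (1 - e * \<beta>)) \<longlongrightarrow> l) (at_right 0)" by simp
  have "((\<lambda>e. e * \<beta>) \<longlongrightarrow> 0 * \<beta>) (at_right 0)" by (intro tendsto_intros)
  then have "((\<lambda>e. e * \<beta>) \<longlongrightarrow> 0) (at_right 0)" by simp
  then have "\<forall>\<^sub>F e in at_right 0. e * \<beta> < 1" by (rule order_tendstoD) simp
  moreover have "\<forall>\<^sub>F e in at_right (0::real). 0 < e" by (rule eventually_at_right_less)
  ultimately have "\<forall>\<^sub>F e in at_right 0. 0 < l + e * c / (1 - e * \<beta>) \<and> l + e * c / (1 - e * \<beta>) < 1 \<and> e * \<beta> < 1 \<and> 0 < e"
    using order_tendstoD[OF l1] l(1,2) by (intro eventually_conj) auto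
  then obtain e where e: "0 < l + e * c / (1 - e * \<beta>)" "l + e * c / (1 - e * \<beta>) < 1" "e * \<beta> < 1" "0 < e"
    using eventually_happens' trivial_limit_at_right_real by blast
  \<comment> \<open>The side parameter for which weight \<open>e * \<beta>\<close> on
    \<open>z\<close> produces exactly \<open>p + e u\<close>; \<open>e\<close> was taken small
    enough that \<open>m\<close> stays strictly between 0 and 1.\<close>
  define m where "m = l + e * c / (1 - e * \<beta>)"
  have "(1 - m) *\<^sub>R a + m *\<^sub>R b \<in> K"
    using convexD_alt[OF convex_region, of a b m] vtx_region e(1,2) by (simp add: a_def b_def m_def)
  then have "(1 - e * \<beta>) *\<^sub>R ((1 - m) *\<^sub>R a + m *\<^sub>R b) + (e * \<beta>) *\<^sub>R z \<in> K"
    using e \<beta> z convexD_alt[OF convex_region, of "(1 - m) *\<^sub>R a + m *\<^sub>R b" z "e * \<beta>"] by simp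
  moreover have "(1 - e * \<beta>) *\<^sub>R ((1 - m) *\<^sub>R a + m *\<^sub>R b) + (e * \<beta>) *\<^sub>R z = p + of_real e * u"
  proof -
    have "(1 - e * \<beta>) * m = (1 - e * \<beta>) * l + e * c"
      using e(3) by (simp add: m_def field_simps)
    have "(1 - m) *\<^sub>R a + m *\<^sub>R b = a + m *\<^sub>R d" by (simp add: d algebra_simps)
    then have "(1 - e * \<beta>) *\<^sub>R ((1 - m) *\<^sub>R a + m *\<^sub>R b) = (1 - e * \<beta>) *\<^sub>R a + ((1 - e * \<beta>) * m) *\<^sub>R d"
      by (simp add: scaleR_add_right)
    also have "\<dots> = (1 - e * \<beta>) *\<^sub>R (a + l *\<^sub>R d) + (e * c) *\<^sub>R d"
      unfolding \<open>(1 - e * \<beta>) * m = _\<close> by (simp add: algebra_simps)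
    also have "a + l *\<^sub>R d = p" by (simp add: l(3) d algebra_simps)
    finally show ?thesis
      unfolding scaleR_conv_of_real [of e u, symmetric] unfolding c by (simp add: algebra_simps)
  qed
  ultimately have "e \<le> flight_time K p u"
    using flight_max[of p u e] good_region[OF assms] i(5) e(4) by simp
  then show ?thesis using e(4) by simp
qed

definition step where "step = billiard_step vs"

lemma fst_step: "fst (step (p, u)) = p + of_real (flight_time K p u) * u"
  and snd_step: "snd (step (p, u)) = bounce vs (fst (step (p, u))) u"
  by (simp_all add: step_def billiard_step_def Let_def)

lemma bounce_side:
  assumes "i < length vs" "p \<in> side vs i" "p \<notin> set vs"
  shows "bounce vs p u = mirror (side_dir vs i) u"
proof -
  have "(SOME j. j < length vs \<and> p \<in> side vs j) = i"
    using assms side_unique by (intro some_equality) auto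
  then show ?thesis
    using assms ex_vtx_iff by (simp add: bounce_def)
qed

text \<open>A state carries the outgoing velocity. Bouncing it recovers the incoming one, whose
  negative is the outgoing velocity of the reversed trajectory.\<close>

definition rev_state :: "complex \<times> complex \<Rightarrow> complex \<times> complex" where
  "rev_state s = (fst s, - bounce vs (fst s) (snd s))"

lemma bounce_good: "good i s \<Longrightarrow> bounce vs (fst s) u = mirror (side_dir vs i) u"
  using bounce_side good_active by (auto simp: good_def)

lemma good_rev: "good i s \<Longrightarrow> good i (rev_state s)"
  using side_dir_nz[OF good_active, of i s] nrm_cases[of i] inner_mirror[of "side_dir vs i" "nrm i"]
  by (auto simp: rev_state_def bounce_good) (auto simp: good_def)

lemma rev_rev: "good i s \<Longrightarrow> rev_state (rev_state s) = s"
  using side_dir_nz[OF good_active, of i s]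
  by (simp add: rev_state_def bounce_good mirror_minus)

text \<open>One collision in full: the end of the flight is a frontier point, the side there is met
  transversally, and the reversed state flies back to the start.\<close>

lemma step_hit:
  assumes "good i s" "fst (step s) \<notin> set vs"
  obtains j where "good j (step s)" "snd (step s) = mirror (side_dir vs j) (snd s)" "snd s \<bullet> nrm j < 0"
    "step (rev_state (step s)) = rev_state s"
proof -
  obtain p u where s: "s = (p, u)" by (cases s)
  define t where "t = flight_time K p u"
  define h where "h = p + of_real t * u"
  have h: "fst (step s) = h" by (simp add: s fst_step h_def t_def)
  have hV: "h \<notin> set vs" using assms(2) h by simp
  have p: "p \<in> K" "norm u = 1" "active i" "p \<in> side vs i" "p \<notin> set vs" "0 < u \<bullet> nrm i"
    using assms(1) good_region[OF assms(1)] by (auto simp: s good_def)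
  have t: "t > 0" using flight_pos assms(1) by (simp add: s t_def)
  have hK: "h \<in> K" using flight_end[OF p(1,2)] by (simp add: h_def t_def)
  have hfr: "h \<in> frontier K"
  proof -
    have "h \<notin> interior K"
    proof
      assume "h \<in> interior K"
      then obtain e where e: "e > 0" "cball h e \<subseteq> K" using mem_interior_cball by blast
      have "h + of_real e * u \<in> K"
        using e p(2) by (intro subsetD[OF e(2)]) (simp add: dist_norm norm_mult)
      then have "p + of_real (t + e) * u \<in> K" by (simp add: h_def algebra_simps)
      then show False using flight_max[OF p(1,2), of "t + e"] t e by (simp add: t_def)
    qed
    then show ?thesis using hK closed_region by (simp add: frontier_def)
  qed
  obtain j where j: "active j" "h \<in> side vs j" using frontier_nonvertex[OF hfr hV] .
  have jl: "j < length vs" using j by (simp add: active_def)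
  have b: "bounce vs h v = mirror (side_dir vs j) v" for v using bounce_side[OF jl j(2) hV] .
  have un: "u \<bullet> nrm j < 0"
  proof -
    have ph: "(p - h) \<bullet> nrm j = - t * (u \<bullet> nrm j)"
      by (simp add: h_def flip: scaleR_conv_of_real)
    moreover have "0 \<le> (p - h) \<bullet> nrm j" using active_support[OF j p(1)] .
    ultimately have "u \<bullet> nrm j \<le> 0" using t by (simp add: mult_le_0_iff zero_le_mult_iff)
    \<comment> \<open>If \<open>u\<close> ran along side \<open>j\<close>, then \<open>p\<close>
      would lie on its supporting line. As \<open>p\<close> is a relative interior point of side
      \<open>i\<close>, the two normals would be parallel, contradicting that \<open>u\<close>
      points strictly inward at \<open>p\<close>.\<close>
    moreover have "u \<bullet> nrm j \<noteq> 0"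
    proof
      assume u0: "u \<bullet> nrm j = 0"
      then have "(p - h) \<bullet> nrm j = 0" using ph by simp
      then have "0 \<le> (y - p) \<bullet> nrm j" if "y \<in> K" for y
        using active_support[OF j that] by (simp add: inner_diff_left)
      then have "nrm j \<bullet> side_dir vs i = 0"
        unfolding side_dir_def using vtx_region by (intro supporting_perp[OF side_open[OF p(4,5)]]) auto
      moreover have "i < length vs" using p(3) by (simp add: active_def)
      ultimately obtain c where c: "nrm j = of_real c * (\<i> * sgn (side_dir vs i))"
        using perp_eq_scaled_normal side_dir_nz by blast
      then have "nrm j = of_real c * nrm i \<or> nrm j = - of_real c * nrm i"
        using nrm_cases[of i] by auto
      then obtain c' where "nrm j = c' *\<^sub>R nrm i"
        by (metis scaleR_conv_of_real of_real_minus)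
      then show False using u0 p(6) norm_nrm[OF jl] by auto
    qed
    ultimately show ?thesis by simp
  qed
  have st: "step s = (h, mirror (side_dir vs j) u)"
    using h snd_step[of p u] b by (metis prod.collapse s)
  have nz: "side_dir vs j \<noteq> 0" using side_dir_nz[OF jl] .
  have good: "good j (step s)"
    using j hV p(2) un inner_mirror[OF nz nrm_cases, of u] nz by (simp add: st good_def)
  have rs: "rev_state (step s) = (h, - u)"
    using nz by (simp add: st rev_state_def b)
  \<comment> \<open>The backward flight stops exactly at \<open>p\<close>, since beyond
    \<open>p\<close> it crosses the active side \<open>i\<close>.\<close>
  have "flight_time K h (- u) = t"
  proof (rule flight_eqI)
    show "h + of_real t * - u \<in> K" using p(1) by (simp add: h_def)
    show "h + of_real t' * - u \<notin> K" if "t' > t" for t'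
      using leave_region[OF p(3,4), of "- u" "t' - t"] p(6) that
      by (simp add: h_def algebra_simps)
  qed (use hK p(2) t in auto)
  then have "fst (step (h, - u)) = p" by (simp add: fst_step h_def)
  then have "step (h, - u) = rev_state s"
    using snd_step[of h "- u"] bounce_good[OF assms(1)]
    by (simp add: s rev_state_def prod_eq_iff mirror_minus)
  moreover have "snd (step s) = mirror (side_dir vs j) (snd s)" "snd s \<bullet> nrm j < 0"
    using un st s by simp_all
  ultimately show ?thesis using that[of j] good rs by simp
qed

text \<open>Reversing, stepping and reversing again recovers \<open>s\<close> from
  \<open>step s\<close>.\<close>

lemma step_inj:
  assumes "good i s" "good j s'" "fst (step s) \<notin> set vs" "step s = step s'"
  shows "s = s'"
proof -
  have "step (rev_state (step s)) = rev_state s" "step (rev_state (step s')) = rev_state s'"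
    using step_hit[OF assms(1)] step_hit[OF assms(2)] assms(3,4) by simp_all blast+
  then have "rev_state (rev_state s) = rev_state (rev_state s')" using assms(4) by simp
  then show ?thesis using rev_rev assms(1,2) by simp
qed

lemma step_pow_inj:
  assumes "\<And>j. j \<le> k \<Longrightarrow> \<exists>i. good i ((step ^^ j) s)" "\<And>j. j \<le> k \<Longrightarrow> \<exists>i. good i ((step ^^ j) s')"
    and "(step ^^ k) s = (step ^^ k) s'"
  shows "s = s'"
  using assms
proof (induction k)
  case (Suc k)
  obtain i i' i'' where g: "good i ((step ^^ k) s)" "good i' ((step ^^ k) s')" "good i'' ((step ^^ Suc k) s)"
    using Suc.prems(1)[of k] Suc.prems(2)[of k] Suc.prems(1)[of "Suc k"] by auto
  then have "fst (step ((step ^^ k) s)) \<notin> set vs" by (simp add: good_def)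
  then have "(step ^^ k) s = (step ^^ k) s'"
    using step_inj[OF g(1,2)] Suc.prems(3) by simp
  moreover have "\<exists>i. good i ((step ^^ j) s)" "\<exists>i. good i ((step ^^ j) s')" if "j \<le> k" for j
    using Suc.prems(1,2) that by auto
  ultimately show ?case using Suc.IH by blast
qed simp

lemma step_pow_rev:
  assumes "\<And>j. j \<le> k \<Longrightarrow> \<exists>i. good i ((step ^^ j) s)"
  shows "(step ^^ k) (rev_state ((step ^^ k) s)) = rev_state s"
  using assms
proof (induction k)
  case (Suc k)
  obtain i i' where i: "good i ((step ^^ k) s)" "good i' ((step ^^ Suc k) s)"
    using Suc.prems[of k] Suc.prems[of "Suc k"] by auto
  then have "fst (step ((step ^^ k) s)) \<notin> set vs" by (simp add: good_def)
  then have "step (rev_state (step ((step ^^ k) s))) = rev_state ((step ^^ k) s)"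
    using step_hit[OF i(1)] by blast
  then have "(step ^^ Suc k) (rev_state ((step ^^ Suc k) s)) = (step ^^ k) (rev_state ((step ^^ k) s))"
    by (simp add: funpow_swap1)
  then show ?case using Suc.IH Suc.prems by simp
qed simp

subsection \<open>Perpendicular trajectories that hit a vertex\<close>

text \<open>With \<open>e\<close> the direction of side \<open>i\<close>, the set is
  \<open>e\<close> times the \<open>M\<close>-th roots of unity: reflection in side \<open>j\<close>
  sends \<open>e w\<close> to \<open>e cis (2 \<theta> j) cnj w\<close>.\<close>

lemma finite_directions:
  assumes "rational_polygon vs" "i < length vs"
  obtains D where "finite D" "nrm i \<in> D" "\<And>j z. j < length vs \<Longrightarrow> z \<in> D \<Longrightarrow> mirror (side_dir vs j) z \<in> D"
proof -
  define e where "e = sgn (side_dir vs i)"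
  have ee: "e * cnj e = 1"
    using side_dir_nz[OF assms(2)] by (simp add: e_def complex_norm_square [symmetric] norm_sgn)
  have "\<forall>j\<in>{..<length vs}. \<exists>\<theta> m. m > 0 \<and> cis (2 * \<theta>) ^ m = 1 \<and> sgn (side_dir vs j) = cis \<theta> * e"
    using assms rational_angle_power unfolding rational_polygon_def e_def by (meson lessThan_iff)
  then obtain \<theta> m where m: "\<And>j. j < length vs \<Longrightarrow> m j > 0 \<and> cis (2 * \<theta> j) ^ m j = 1 \<and> sgn (side_dir vs j) = cis (\<theta> j) * e"
    by (metis lessThan_iff)
  \<comment> \<open>The product is a multiple of all the exponents \<open>m j\<close>; the factor 4
    makes \<open>\<i>\<close> and \<open>- \<i>\<close> roots of unity of order dividing
    \<open>M\<close>, so that \<open>nrm i\<close> belongs to \<open>D\<close>.\<close>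
  define M where "M = 4 * (\<Prod>j<length vs. m j)"
  have M: "M > 0" using m by (auto simp: M_def intro!: prod_pos)
  have MM: "cis (2 * \<theta> j) ^ M = 1" if "j < length vs" for j
  proof -
    have "m j dvd M" using that unfolding M_def by (intro dvd_mult dvd_prodI) auto
    then show ?thesis using m[OF that] by (auto simp: power_mult elim!: dvdE)
  qed
  define D where "D = (\<lambda>w. e * w) ` {w. w ^ M = 1}"
  show ?thesis
  proof
    show "finite D" using M by (auto simp: D_def intro!: finite_imageI finite_roots_unity)
    have "\<i> ^ M = 1" "(- \<i>) ^ M = 1" by (simp_all add: M_def power_mult)
    then show "nrm i \<in> D"
      unfolding D_def e_def using nrm_cases[of i]
      by (elim disjE) (auto intro: image_eqI[of _ _ "\<i>"] image_eqI[of _ _ "- \<i>"])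
    fix j z assume j: "j < length vs" and "z \<in> D"
    then obtain w where w: "z = e * w" "w ^ M = 1" by (auto simp: D_def)
    have "mirror (side_dir vs j) z = (e * cnj e) * (e * (cis (\<theta> j) ^ 2 * cnj w))"
      unfolding mirror_def w(1) using m[OF j] by (simp add: power2_eq_square mult_ac)
    also have "cis (\<theta> j) ^ 2 = cis (2 * \<theta> j)" by (simp add: Complex.DeMoivre)
    finally have "mirror (side_dir vs j) z = e * (cis (2 * \<theta> j) * cnj w)" by (simp add: ee)
    moreover have "(cis (2 * \<theta> j) * cnj w) ^ M = 1"
      using MM[OF j] w(2) by (simp add: power_mult_distrib flip: complex_cnj_power)
    ultimately show "mirror (side_dir vs j) z \<in> D" by (auto simp: D_def)
  qed
qed

definition orb :: "nat \<Rightarrow> complex \<Rightarrow> nat \<Rightarrow> complex \<times> complex" where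
  "orb i x k = (step ^^ k) (x, nrm i)"

text \<open>The velocity is the one after the bounce, so this is a perpendicular arrival; the foot
  may differ from the starting one.\<close>

definition ret :: "nat \<Rightarrow> complex \<times> complex \<Rightarrow> bool" where
  "ret i s \<longleftrightarrow> fst s \<in> side vs i \<and> snd s = nrm i"

text \<open>Excluding earlier returns makes the foot and the number of collisions recoverable from
  the state reached.\<close>

definition regular :: "nat \<Rightarrow> complex \<Rightarrow> nat \<Rightarrow> bool" where
  "regular i x k \<longleftrightarrow> (\<forall>j\<le>k. \<exists>l. good l (orb i x j)) \<and> (\<forall>j. 1 \<le> j \<and> j \<le> k \<longrightarrow> \<not> ret i (orb i x j))"

lemma regular_good: "regular i x k \<Longrightarrow> j \<le> k \<Longrightarrow> \<exists>l. good l (orb i x j)"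
  by (simp add: regular_def)

definition exceptional :: "nat \<Rightarrow> complex set" where
  "exceptional i = {x \<in> side vs i - set vs. \<exists>k. regular i x k \<and> fst (orb i x (Suc k)) \<in> set vs}"

lemma orb_0 [simp]: "orb i x 0 = (x, nrm i)"
  and orb_Suc: "orb i x (Suc k) = step (orb i x k)"
  and orb_add: "orb i x (k + l) = (step ^^ k) (orb i x l)"
  by (simp_all add: orb_def funpow_add)

text \<open>Cancelling \<open>k\<close> steps by injectivity leaves the initial state of
  \<open>x\<close> as a state on the orbit of \<open>y\<close>. That is a perpendicular return after
  \<open>l - k\<close> collisions, which regularity forbids unless \<open>k = l\<close>.\<close>

lemma orb_eq_less:
  assumes "regular i x k" "regular i y l" "orb i x k = orb i y l" "k \<le> l" "x \<in> side vs i"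
  shows "x = y \<and> k = l"
proof -
  have eq: "(x, nrm i) = orb i y (l - k)"
  proof (rule step_pow_inj[of k])
    show "\<exists>i'. good i' ((step ^^ j) (x, nrm i))" if "j \<le> k" for j
      using assms(1) that by (auto simp: regular_def orb_def)
    show "\<exists>i'. good i' ((step ^^ j) (orb i y (l - k)))" if "j \<le> k" for j
      using assms(2,4) that by (auto simp: regular_def orb_add[symmetric])
    show "(step ^^ k) (x, nrm i) = (step ^^ k) (orb i y (l - k))"
      using assms(3,4) by (simp add: orb_add[symmetric]) (simp add: orb_def)
  qed
  then have "ret i (orb i y (l - k))" using assms(5) by (simp add: ret_def flip: eq)
  then have "\<not> 1 \<le> l - k" using assms(2) diff_le_self by (auto simp: regular_def)
  then show ?thesis using eq assms(4) by auto
qed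

lemma orb_eq:
  assumes "regular i x k" "regular i y l" "orb i x k = orb i y l" "x \<in> side vs i" "y \<in> side vs i"
  shows "x = y" "k = l"
  using orb_eq_less[OF assms(1,2,3) _ assms(4)] orb_eq_less[OF assms(2,1) assms(3)[symmetric] _ assms(5)]
    nat_le_linear[of k l] by blast+

text \<open>Going back from the point of impact, the chord can only leave \<open>K\<close> at one point.\<close>

lemma same_hit:
  assumes "good l (p, d)" "good l' (p', d)" "fst (step (p, d)) = fst (step (p', d))"
  shows "p = p'"
proof -
  have *: False
    if "good l (p, d)" "p' \<in> K" "t < t'" "p + of_real t * d = p' + of_real t' * d" for l p p' t t'
  proof -
    have "p' = p + of_real (t' - t) * - d" using that(4) by (simp add: algebra_simps)
    then show False
      using leave_region[of l p "- d" "t' - t"] that(1-3) by (auto simp: good_def)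
  qed
  have "p \<in> K" "p' \<in> K" using good_region assms(1,2) by fastforce+
  then have "\<not> flight_time K p d < flight_time K p' d" "\<not> flight_time K p' d < flight_time K p d"
    using *[OF assms(1)] *[OF assms(2)] assms(3) unfolding fst_step by metis+
  then show ?thesis using assms(3) unfolding fst_step by simp
qed

lemma directions:
  assumes "nrm i \<in> D" "\<And>j z. j < length vs \<Longrightarrow> z \<in> D \<Longrightarrow> mirror (side_dir vs j) z \<in> D"
    and "regular i x k"
  shows "snd (orb i x k) \<in> D"
  using assms(3)
proof (induction k)
  case (Suc k)
  then have k: "regular i x k" by (auto simp: regular_def)
  have "\<exists>l. good l (orb i x k)" "\<exists>l. good l (orb i x (Suc k))"
    using Suc.prems by (simp_all add: regular_def)
  then obtain l l' where "good l (orb i x k)" "good l' (step (orb i x k))"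
    unfolding orb_Suc by blast
  then obtain j where j: "good j (step (orb i x k))" "snd (step (orb i x k)) = mirror (side_dir vs j) (snd (orb i x k))"
    using step_hit[of l "orb i x k"] by (auto simp: good_def)
  then show ?case using assms(2)[OF good_active[OF j(1)] Suc.IH[OF k]] by (simp add: orb_Suc)
qed (simp add: assms(1))

lemma finite_exceptional:
  assumes "rational_polygon vs" "i < length vs"
  shows "finite (exceptional i)"
proof -
  obtain D where D: "finite D" "nrm i \<in> D" "\<And>j z. j < length vs \<Longrightarrow> z \<in> D \<Longrightarrow> mirror (side_dir vs j) z \<in> D"
    using finite_directions[OF assms] by metis
  have "\<forall>x\<in>exceptional i. \<exists>k. regular i x k \<and> fst (orb i x (Suc k)) \<in> set vs"
    unfolding exceptional_def by blast
  from bchoice[OF this] obtain \<kappa>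
    where \<kappa>: "\<And>x. x \<in> exceptional i \<Longrightarrow> regular i x (\<kappa> x) \<and> fst (orb i x (Suc (\<kappa> x))) \<in> set vs"
    by blast
  \<comment> \<open>The position is that of the vertex, but the velocity is taken one collision
    earlier: it is the velocity of arrival, known to lie in \<open>D\<close>.\<close>
  define f where "f = (\<lambda>x. (fst (orb i x (Suc (\<kappa> x))), snd (orb i x (\<kappa> x))))"
  have "inj_on f (exceptional i)"
  proof (rule inj_onI)
    fix x y assume x: "x \<in> exceptional i" and y: "y \<in> exceptional i" and f: "f x = f y"
    obtain l l' where l: "good l (orb i x (\<kappa> x))" "good l' (orb i y (\<kappa> y))"
      using \<kappa>[OF x] \<kappa>[OF y] regular_good by blast
    obtain p d where p: "orb i x (\<kappa> x) = (p, d)" by fastforce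
    obtain p' where p': "orb i y (\<kappa> y) = (p', d)"
      using f p by (cases "orb i y (\<kappa> y)") (auto simp: f_def)
    have "p = p'" using same_hit[of l p d l' p'] l p p' f by (simp add: f_def orb_Suc)
    then show "x = y"
      using orb_eq(1)[of i x "\<kappa> x" y "\<kappa> y"] \<kappa>[OF x] \<kappa>[OF y] p p' x y by (auto simp: exceptional_def)
  qed
  moreover have "f ` exceptional i \<subseteq> set vs \<times> D" using \<kappa> directions[OF D(2,3)] by (auto simp: f_def)
  ultimately show ?thesis using D(1) by (meson finite_SigmaI finite_set inj_on_finite)
qed

section \<open>Transport of a strip of parallel trajectories through one collision\<close>

definition projection :: "nat \<Rightarrow> complex \<Rightarrow> complex \<Rightarrow> complex" where
  "projection j d p = p - of_real (((p - vtx vs j) \<bullet> nrm j) / (d \<bullet> nrm j)) * d"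

text \<open>Projecting along \<open>d\<close> replaces the flight by an affine map. The second part
  works because side \<open>j\<close> is active: a trajectory crossing it outward leaves
  \<open>K\<close>, so a projection landing on the side is the actual impact.\<close>

lemma projection_hit:
  assumes "good i (p, d)" "active j" "d \<bullet> nrm j < 0"
  shows "fst (step (p, d)) \<in> side vs j \<Longrightarrow> fst (step (p, d)) = projection j d p"
    and "projection j d p \<in> side vs j \<Longrightarrow> fst (step (p, d)) = projection j d p"
proof -
  define t where "t = flight_time K p d"
  have h: "fst (step (p, d)) = p + of_real t * d" by (simp add: fst_step t_def)
  show "fst (step (p, d)) = projection j d p" if "fst (step (p, d)) \<in> side vs j"
  proof -
    have "(p + of_real t * d - vtx vs j) \<bullet> nrm j = 0"
      using on_side[OF that, of "fst (step (p, d))"] by (simp add: h)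
    then have "(p - vtx vs j) \<bullet> nrm j + t * (d \<bullet> nrm j) = 0"
      by (simp add: inner_diff_left inner_add_left flip: scaleR_conv_of_real)
    then have "t = - ((p - vtx vs j) \<bullet> nrm j) / (d \<bullet> nrm j)"
      using assms(3) by (simp add: field_simps)
    then show ?thesis by (simp add: h projection_def)
  qed
  show "fst (step (p, d)) = projection j d p" if pr: "projection j d p \<in> side vs j"
  proof -
    define t' where "t' = - ((p - vtx vs j) \<bullet> nrm j) / (d \<bullet> nrm j)"
    have p: "p \<in> K" "norm d = 1" using assms(1) good_region by (fastforce simp: good_def)+
    have pj: "projection j d p = p + of_real t' * d" by (simp add: projection_def t'_def)
    have "flight_time K p d = t'"
    proof (rule flight_eqI)
      show "0 \<le> t'"
        using assms(2,3) p by (auto simp: t'_def active_def divide_nonneg_neg divide_nonpos_neg)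
      show "p + of_real t' * d \<in> K"
        using pr side_subset assms(2) unfolding pj active_def by blast
      show "p + of_real r * d \<notin> K" if "r > t'" for r
        using leave_region[OF assms(2) pr assms(3), of "r - t'"] that
        by (simp add: pj algebra_simps)
    qed (use p in auto)
    then show ?thesis by (simp add: fst_step pj)
  qed
qed

text \<open>The set of parameters hitting a fixed side is relatively closed, and these sets are disjoint, so
by connectedness all trajectories of the strip hit the same side.\<close>

lemma strip_side:
  fixes P W :: complex
  assumes I: "connected I"
    and g: "\<And>r. r \<in> I \<Longrightarrow> good l (P + of_real r * W, d)"
    and V: "\<And>r. r \<in> I \<Longrightarrow> fst (step (P + of_real r * W, d)) \<notin> set vs"
    and r0: "r0 \<in> I"
  obtains j where "active j" "d \<bullet> nrm j < 0"
    "\<And>r. r \<in> I \<Longrightarrow> step (P + of_real r * W, d) = (projection j d (P + of_real r * W), mirror (side_dir vs j) d)"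
    "\<And>r. r \<in> I \<Longrightarrow> good j (step (P + of_real r * W, d))"
proof -
  define S where "S = (\<lambda>r. step (P + of_real r * W, d))"
  define J where "J = {j. active j \<and> d \<bullet> nrm j < 0}"
  define C where "C = (\<lambda>j. {r. projection j d (P + of_real r * W) \<in> side vs j})"
  have hit: "\<exists>j\<in>J. good j (S r) \<and> snd (S r) = mirror (side_dir vs j) d" if r: "r \<in> I" for r
  proof -
    obtain j where "good j (S r)" "snd (S r) = mirror (side_dir vs j) d" "d \<bullet> nrm j < 0"
      using step_hit[OF g[OF r] V[OF r]] by (auto simp: S_def)
    then show ?thesis by (auto simp: J_def good_def)
  qed
  have "finite J" by (rule finite_subset[of _ "{..<length vs}"]) (auto simp: J_def active_def)
  have closed: "closed (C j)" for j
  proof -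
    have "C j = (\<lambda>r. projection j d (P + of_real r * W)) -` side vs j" by (auto simp: C_def)
    then show ?thesis unfolding projection_def side_def divide_inverse
      by (auto intro!: closed_vimage continuous_intros)
  qed
  have C: "r \<in> C j \<longleftrightarrow> good j (S r)" if "r \<in> I" "j \<in> J" for r j
  proof
    assume "r \<in> C j"
    then have "fst (S r) \<in> side vs j"
      using projection_hit(2)[OF g[OF that(1)], of j] that(2) by (auto simp: S_def C_def J_def)
    then show "good j (S r)"
      using hit[OF that(1)] good_unique that(2) by (metis CollectD J_def active_def)
  next
    assume "good j (S r)"
    then have "fst (S r) \<in> side vs j" by (simp add: good_def)
    then show "r \<in> C j"
      using projection_hit(1)[OF g[OF that(1)], of j] that(2) by (auto simp: S_def C_def J_def)
  qed
  obtain j where j: "j \<in> J" "good j (S r0)" using hit[OF r0] by blast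
  define B where "B = (\<Union>k\<in>J - {j}. C k)"
  have "closed B" using \<open>finite J\<close> closed unfolding B_def by (intro closed_UN) auto
  moreover have "I \<subseteq> C j \<union> B"
  proof
    fix r assume r: "r \<in> I"
    then obtain k where "k \<in> J" "good k (S r)" using hit by blast
    then show "r \<in> C j \<union> B" using C[OF r] by (auto simp: B_def)
  qed
  moreover have "C j \<inter> B \<inter> I = {}"
  proof -
    have False if r: "r \<in> I" "r \<in> C j" "r \<in> C k" "k \<in> J - {j}" for r k
    proof -
      have gk: "good j (S r)" "good k (S r)" using C[OF r(1)] r j(1) by auto
      then have "j = k" using good_unique[OF gk(1), of k] good_active[OF gk(2)] by (simp add: good_def)
      then show False using r(4) by simp
    qed
    then show ?thesis by (auto simp: B_def)
  qed
  moreover have "C j \<inter> I \<noteq> {}" using C[OF r0 j(1)] j(2) r0 by blast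
  ultimately have "B \<inter> I = {}" using closed[of j] I unfolding connected_closed by blast
  with \<open>I \<subseteq> C j \<union> B\<close> have "I \<subseteq> C j" by blast
  then have good: "good j (S r)" if "r \<in> I" for r using C[OF that j(1)] that by blast
  have snd: "snd (S r) = mirror (side_dir vs j) d" if r: "r \<in> I" for r
  proof -
    obtain k where "good k (S r)" "snd (S r) = mirror (side_dir vs k) d" using hit[OF r] by blast
    moreover have "k = j" using good_unique[OF \<open>good k (S r)\<close>, of j] good[OF r] good_active by (auto simp: good_def)
    ultimately show ?thesis by simp
  qed
  have fst: "fst (S r) = projection j d (P + of_real r * W)" if r: "r \<in> I" for r
    using projection_hit(1)[OF g[OF r], of j] good[OF r] j(1) by (auto simp: S_def J_def good_def)
  show ?thesis
  proof
    show "active j" "d \<bullet> nrm j < 0" using j(1) by (auto simp: J_def)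
    fix r assume "r \<in> I"
    then show "step (P + of_real r * W, d) = (projection j d (P + of_real r * W), mirror (side_dir vs j) d)"
      "good j (step (P + of_real r * W, d))"
      using fst snd good by (simp_all add: S_def prod_eq_iff)
  qed
qed

lemma projection_affine:
  "projection j d (P + of_real r * W) = projection j d P + of_real r * (W - of_real ((W \<bullet> nrm j) / (d \<bullet> nrm j)) * d)"
proof -
  have "(P + of_real r * W - vtx vs j) \<bullet> nrm j = (P - vtx vs j) \<bullet> nrm j + r * (W \<bullet> nrm j)"
    by (simp add: inner_diff_left inner_add_left flip: scaleR_conv_of_real)
  then show ?thesis
    unfolding projection_def by (simp add: add_divide_distrib diff_divide_distrib algebra_simps)
qed

subsection \<open>Recurrence of perpendicular trajectories\<close>

text \<open>The strip of half-width \<open>\<epsilon>\<close> around the trajectory of \<open>x\<close> after \<open>k\<close> collisions: it meets side \<open>l\<close>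
in the points \<open>P + r W\<close> and leaves with velocity \<open>d\<close>. The cross product of \<open>d\<close> and \<open>W\<close> is the transversal
stretching of the strip, which is preserved by flight and changes sign under reflection.\<close>

definition strip :: "nat \<Rightarrow> complex \<Rightarrow> real \<Rightarrow> nat \<Rightarrow> complex \<times> complex \<times> complex \<times> nat \<Rightarrow> bool" where
  "strip i x \<epsilon> k = (\<lambda>(P, W, d, l). \<bar>Im (cnj d * W)\<bar> = 1 \<and>
     (\<forall>r. \<bar>r\<bar> < \<epsilon> \<longrightarrow> orb i (x + of_real r * sgn (side_dir vs i)) k = (P + of_real r * W, d) \<and>
        good l (P + of_real r * W, d)))"

lemma strip_0:
  assumes "i < length vs" "\<And>r. \<bar>r\<bar> < \<epsilon> \<Longrightarrow> good i (x + of_real r * sgn (side_dir vs i), nrm i)"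
  shows "strip i x \<epsilon> 0 (x, sgn (side_dir vs i), nrm i, i)"
proof -
  define e where "e = sgn (side_dir vs i)"
  have "e * cnj e = 1"
    using side_dir_nz[OF assms(1)] by (simp add: e_def complex_norm_square [symmetric] norm_sgn)
  then have "cnj e * e = 1" by (simp only: mult.commute)
  moreover have "cnj (nrm i) * e = - (\<i> * (cnj e * e)) \<or> cnj (nrm i) * e = \<i> * (cnj e * e)"
    using nrm_cases[of i] unfolding e_def by auto
  ultimately have "\<bar>Im (cnj (nrm i) * e)\<bar> = 1" by (auto simp only:) simp_all
  then have "\<bar>Im (cnj (nrm i) * sgn (side_dir vs i))\<bar> = 1" by (simp only: e_def)
  then show ?thesis using assms(2) by (simp add: strip_def)
qed

text \<open>The whole strip hits one side \<open>j\<close>. Flight changes \<open>W\<close> by a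
  multiple of \<open>d\<close>, which keeps the cross product; the new \<open>W'\<close> runs along
  side \<open>j\<close>, so the reflection only flips the sign.\<close>

lemma strip_Suc:
  assumes "strip i x \<epsilon> k (P, W, d, l)" "\<epsilon> > 0"
    and V: "\<And>r. \<bar>r\<bar> < \<epsilon> \<Longrightarrow> fst (orb i (x + of_real r * sgn (side_dir vs i)) (Suc k)) \<notin> set vs"
  shows "\<exists>t. strip i x \<epsilon> (Suc k) t"
proof -
  have cross: "\<bar>Im (cnj d * W)\<bar> = 1"
    and orb: "\<And>r. \<bar>r\<bar> < \<epsilon> \<Longrightarrow> orb i (x + of_real r * sgn (side_dir vs i)) k = (P + of_real r * W, d)"
    and g: "\<And>r. \<bar>r\<bar> < \<epsilon> \<Longrightarrow> good l (P + of_real r * W, d)"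
    using assms(1) by (auto simp: strip_def)
  have g': "good l (P + of_real r * W, d)" and V': "fst (step (P + of_real r * W, d)) \<notin> set vs"
    if "r \<in> {-\<epsilon><..<\<epsilon>}" for r
  proof -
    have "\<bar>r\<bar> < \<epsilon>" using that by auto
    then show "good l (P + of_real r * W, d)" "fst (step (P + of_real r * W, d)) \<notin> set vs"
      using g[of r] V[of r] orb[of r] by (simp_all add: orb_Suc)
  qed
  have "0 \<in> {-\<epsilon><..<\<epsilon>}" using assms(2) by simp
  then obtain j where j: "active j" "d \<bullet> nrm j < 0"
    "\<And>r. r \<in> {-\<epsilon><..<\<epsilon>} \<Longrightarrow> step (P + of_real r * W, d) = (projection j d (P + of_real r * W), mirror (side_dir vs j) d)"
    "\<And>r. r \<in> {-\<epsilon><..<\<epsilon>} \<Longrightarrow> good j (step (P + of_real r * W, d))"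
    using strip_side[OF connected_Ioo g' V'] by blast
  have jl: "j < length vs" using j(1) by (simp add: active_def)
  define W' where "W' = W - of_real ((W \<bullet> nrm j) / (d \<bullet> nrm j)) * d"
  have "W' \<bullet> nrm j = 0"
    using j(2) unfolding W'_def scaleR_conv_of_real [symmetric] by (simp add: inner_diff_left)
  then obtain c where c: "W' = of_real c * sgn (side_dir vs j)"
    using along_side[OF jl] by blast
  have "Im (cnj d * W') = Im (cnj d * W)"
  proof -
    \<comment> \<open>The correction is a real multiple of \<open>d * cnj d\<close>, hence invisible
      in the imaginary part.\<close>
    have "cnj d * W' = cnj d * W - of_real ((W \<bullet> nrm j) / (d \<bullet> nrm j)) * (d * cnj d)"
      by (simp add: W'_def algebra_simps)
    also have "d * cnj d = of_real ((norm d)\<^sup>2)" by (simp only: complex_norm_square)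
    finally show ?thesis by (simp only: minus_complex.simps Im_complex_of_real of_real_mult [symmetric])
  qed
  then have "\<bar>Im (cnj (mirror (side_dir vs j) d) * W')\<bar> = 1"
    using mirror_cross[OF side_dir_nz[OF jl] c, of d] cross by simp
  then have "strip i x \<epsilon> (Suc k) (projection j d P, W', mirror (side_dir vs j) d, j)"
    using j(3,4) orb projection_affine[of j d P _ W]
    by (auto simp: strip_def orb_Suc W'_def abs_less_iff)
  then show ?thesis by blast
qed

definition returns :: "nat \<Rightarrow> complex \<Rightarrow> bool" where
  "returns i x \<longleftrightarrow> (\<exists>m\<ge>1. (\<forall>j\<le>m. \<exists>l. good l (orb i x j)) \<and> ret i (orb i x m))"

lemma good_normal: "active i \<Longrightarrow> x \<in> side vs i \<Longrightarrow> x \<notin> set vs \<Longrightarrow> good i (x, nrm i)"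
  by (simp add: good_def norm_nrm active_def dot_square_norm)

lemma open_side:
  assumes "i < length vs" "x \<in> side vs i" "x \<notin> set vs"
  obtains \<epsilon> where "\<epsilon> > 0" "\<And>r. \<bar>r\<bar> < \<epsilon> \<Longrightarrow> x + of_real r * sgn (side_dir vs i) \<in> side vs i"
proof -
  define a b where "a = vtx vs i" and "b = vtx vs (Suc i)"
  have d: "side_dir vs i = b - a" by (simp add: a_def b_def side_dir_def)
  obtain l where l: "0 < l" "l < 1" "x = (1 - l) *\<^sub>R a + l *\<^sub>R b"
    using side_open[OF assms(2,3)] by (auto simp: in_segment a_def b_def)
  define n where "n = norm (b - a)"
  have n: "n > 0" using side_dir_nz[OF assms(1)] by (simp add: n_def d)
  show ?thesis
  proof
    show "min l (1 - l) * n > 0" using l n by simp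
    fix r assume "\<bar>r\<bar> < min l (1 - l) * n"
    then have "\<bar>r\<bar> / n < min l (1 - l)" using n by (simp only: pos_divide_less_eq)
    moreover have "\<bar>r / n\<bar> = \<bar>r\<bar> / n" using n by simp
    ultimately have "0 \<le> l + r / n" "l + r / n \<le> 1" by linarith+
    moreover have "x + of_real r * sgn (side_dir vs i) = (1 - (l + r / n)) *\<^sub>R a + (l + r / n) *\<^sub>R b"
    proof -
      have "of_real r * sgn (side_dir vs i) = (r / n) *\<^sub>R (b - a)"
        by (simp add: d sgn_div_norm n_def divide_inverse flip: scaleR_conv_of_real)
      then show ?thesis by (simp add: l(3) algebra_simps)
    qed
    ultimately show "x + of_real r * sgn (side_dir vs i) \<in> side vs i"
      unfolding side_def in_segment a_def b_def by blast
  qed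
qed

text \<open>A finite set is closed, so an interval around \<open>x\<close> avoids all exceptional
  feet and vertices. Its length involves no collision number, which makes the strip uniform in
  time.\<close>

lemma regular_neighbourhood:
  assumes "rational_polygon vs" "active i" "x \<in> side vs i" "x \<notin> set vs" "x \<notin> exceptional i"
  obtains \<epsilon> where "\<epsilon> > 0"
    "\<And>r. \<bar>r\<bar> < \<epsilon> \<Longrightarrow> good i (x + of_real r * sgn (side_dir vs i), nrm i)"
    "\<And>r. \<bar>r\<bar> < \<epsilon> \<Longrightarrow> x + of_real r * sgn (side_dir vs i) \<notin> exceptional i"
proof -
  have i: "i < length vs" using assms(2) by (simp add: active_def)
  obtain \<epsilon> where e: "\<epsilon> > 0" "\<And>r. \<bar>r\<bar> < \<epsilon> \<Longrightarrow> x + of_real r * sgn (side_dir vs i) \<in> side vs i"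
    using open_side[OF i assms(3,4)] by blast
  have "finite (exceptional i \<union> set vs)" using finite_exceptional[OF assms(1) i] by simp
  then have "open (- (exceptional i \<union> set vs))" using finite_imp_closed by blast
  moreover have "x \<in> - (exceptional i \<union> set vs)" using assms by simp
  ultimately obtain \<delta> where \<delta>: "\<delta> > 0" "ball x \<delta> \<subseteq> - (exceptional i \<union> set vs)"
    by (meson open_contains_ball)
  have ball: "x + of_real r * sgn (side_dir vs i) \<in> ball x \<delta>" if "\<bar>r\<bar> < \<delta>" for r
    using that side_dir_nz[OF i] by (simp add: dist_norm norm_mult norm_sgn)
  show ?thesis
  proof
    show "min \<epsilon> \<delta> > 0" using e \<delta> by simp
    fix r assume "\<bar>r\<bar> < min \<epsilon> \<delta>"
    then have "x + of_real r * sgn (side_dir vs i) \<in> side vs i" "x + of_real r * sgn (side_dir vs i) \<in> ball x \<delta>"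
      using e ball by auto
    then show "good i (x + of_real r * sgn (side_dir vs i), nrm i)"
      "x + of_real r * sgn (side_dir vs i) \<notin> exceptional i"
      using \<delta>(2) good_normal[OF assms(2)] by auto
  qed
qed

text \<open>All trajectories of the strip are on the same side with the same velocity at collision
  \<open>k\<close>, so a return of one is a return of the central one.\<close>

lemma strip_not_ret:
  assumes "strip i x \<epsilon> k t" "\<epsilon> > 0" "\<bar>r\<bar> < \<epsilon>" "i < length vs" "\<not> ret i (orb i x k)"
  shows "\<not> ret i (orb i (x + of_real r * sgn (side_dir vs i)) k)"
proof
  assume ret: "ret i (orb i (x + of_real r * sgn (side_dir vs i)) k)"
  obtain P W d l where t: "t = (P, W, d, l)" by (cases t)
  have s: "orb i (x + of_real r * sgn (side_dir vs i)) k = (P + of_real r * W, d)" "good l (P + of_real r * W, d)"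
    "orb i x k = (P, d)" "good l (P, d)"
    using assms(1-3) unfolding strip_def t by (fastforce dest: spec[of _ r] spec[of _ 0])+
  have "l = i" using good_unique[OF s(2), of i] ret assms(4) by (simp add: s(1) ret_def)
  then show False using s(3,4) assms(5) ret s(1) by (simp add: ret_def good_def)
qed

text \<open>The two properties need each other: regularity up to \<open>k\<close> and
  nonexceptionality keep the next collision off the vertices, so the strip continues; the continued
  strip then inherits the absence of returns from \<open>x\<close>, which gives regularity at
  \<open>Suc k\<close>.\<close>

lemma strips:
  assumes "rational_polygon vs" "active i" "x \<in> side vs i" "x \<notin> set vs" "x \<notin> exceptional i" "\<not> returns i x"
  obtains \<epsilon> where "\<epsilon> > 0" "\<And>k. \<exists>t. strip i x \<epsilon> k t"
    "\<And>k r. \<bar>r\<bar> < \<epsilon> \<Longrightarrow> regular i (x + of_real r * sgn (side_dir vs i)) k"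
    "\<And>r. \<bar>r\<bar> < \<epsilon> \<Longrightarrow> x + of_real r * sgn (side_dir vs i) \<in> side vs i"
proof -
  have i: "i < length vs" using assms(2) by (simp add: active_def)
  define y where "y = (\<lambda>r. x + of_real r * sgn (side_dir vs i))"
  obtain \<epsilon> where e: "\<epsilon> > 0" "\<And>r. \<bar>r\<bar> < \<epsilon> \<Longrightarrow> good i (y r, nrm i)" "\<And>r. \<bar>r\<bar> < \<epsilon> \<Longrightarrow> y r \<notin> exceptional i"
    using regular_neighbourhood[OF assms(1-5)] unfolding y_def by blast
  have side: "y r \<in> side vs i - set vs" if "\<bar>r\<bar> < \<epsilon>" for r
    using e(2)[OF that] by (simp add: good_def)
  have main: "(\<exists>t. strip i x \<epsilon> k t) \<and> (\<forall>r. \<bar>r\<bar> < \<epsilon> \<longrightarrow> regular i (y r) k)" for k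
  proof (induction k)
    case 0
    have "strip i x \<epsilon> 0 (x, sgn (side_dir vs i), nrm i, i)"
      using strip_0[OF i] e(2) by (simp add: y_def)
    moreover have "regular i (y r) 0" if "\<bar>r\<bar> < \<epsilon>" for r
      using e(2)[OF that] by (auto simp: regular_def)
    ultimately show ?case by blast
  next
    case (Suc k)
    then obtain P W d l where st: "strip i x \<epsilon> k (P, W, d, l)" by (metis prod.collapse)
    have V: "fst (orb i (y r) (Suc k)) \<notin> set vs" if "\<bar>r\<bar> < \<epsilon>" for r
      using Suc.IH e(3)[OF that] side[OF that] that unfolding exceptional_def by blast
    obtain t where t: "strip i x \<epsilon> (Suc k) t"
      using strip_Suc[OF st e(1)] V unfolding y_def by blast
    have good: "\<exists>l. good l (orb i (y r) (Suc k))" if "\<bar>r\<bar> < \<epsilon>" for r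
      using t that unfolding strip_def y_def by (cases t) auto
    have y0: "y 0 = x" by (simp add: y_def)
    have "\<not> ret i (orb i x (Suc k))"
    proof
      assume "ret i (orb i x (Suc k))"
      moreover have "\<exists>l. good l (orb i x j)" if "j \<le> Suc k" for j
        using that good[of 0] Suc.IH e(1) regular_good[of i x k j] y0 by (cases "j = Suc k") auto
      ultimately show False using assms(6) unfolding returns_def by (metis le_add1 plus_1_eq_Suc)
    qed
    then have nr: "\<not> ret i (orb i (y r) (Suc k))" if "\<bar>r\<bar> < \<epsilon>" for r
      using strip_not_ret[OF t e(1) that i] by (simp add: y_def)
    have "regular i (y r) (Suc k)" if "\<bar>r\<bar> < \<epsilon>" for r
      using Suc.IH that nr[OF that] good[OF that] unfolding regular_def by (metis le_Suc_eq)
    then show ?case using t by blast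
  qed
  show ?thesis
    using that[OF e(1)] main side unfolding y_def by blast
qed

text \<open>A side cuts the strip obliquely: \<open>d\<close> has norm 1 and the cross product has
  absolute value 1, so the trace is stretched by a factor of at least 1.\<close>

lemma strip_along_side:
  assumes "strip i x \<epsilon> k (P, W, d, l)" "\<epsilon> > 0"
  obtains w where "W = of_real w * sgn (side_dir vs l)" "\<bar>w\<bar> \<ge> 1"
proof -
  have cross: "\<bar>Im (cnj d * W)\<bar> = 1" using assms(1) by (simp add: strip_def)
  have g: "good l (P + of_real r * W, d)" if "\<bar>r\<bar> < \<epsilon>" for r using assms(1) that by (simp add: strip_def)
  have P: "P \<in> side vs l" "norm d = 1" using g[of 0] assms(2) by (auto simp: good_def)
  have l: "l < length vs" using good_active[OF g[of 0]] assms(2) by simp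
  have PW: "P + of_real (\<epsilon> / 2) * W \<in> side vs l" using g[of "\<epsilon> / 2"] assms(2) by (simp add: good_def)
  have "(P + of_real (\<epsilon> / 2) * W - P) \<bullet> nrm l = 0"
    using on_side[OF P(1), of "P + of_real (\<epsilon> / 2) * W"] on_side[OF PW, of "P + of_real (\<epsilon> / 2) * W"] by simp
  then have "(\<epsilon> / 2) * (W \<bullet> nrm l) = 0" 
    by (simp only: add_diff_cancel_left' scaleR_conv_of_real [symmetric] inner_scaleR_left)
  then have "W \<bullet> nrm l = 0" using assms(2) by simp
  then obtain w where w: "W = of_real w * sgn (side_dir vs l)" using along_side[OF l] by blast
  have "1 \<le> norm (cnj d * W)" using abs_Im_le_cmod[of "cnj d * W"] cross by linarith
  also have "\<dots> = \<bar>w\<bar>" using P(2) side_dir_nz[OF l] by (simp add: norm_mult w norm_sgn)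
  finally show ?thesis using that w by blast
qed

lemma nonexceptional_returns:
  assumes "rational_polygon vs" "active i" "x \<in> side vs i" "x \<notin> set vs" "x \<notin> exceptional i"
  shows "returns i x"
proof (rule ccontr)
  assume nret: "\<not> returns i x"
  have i: "i < length vs" using assms(2) by (simp add: active_def)
  define y where "y = (\<lambda>r. x + of_real r * sgn (side_dir vs i))"
  obtain \<epsilon> where e: "\<epsilon> > 0" "\<And>k. \<exists>t. strip i x \<epsilon> k t" "\<And>k r. \<bar>r\<bar> < \<epsilon> \<Longrightarrow> regular i (y r) k"
    "\<And>r. \<bar>r\<bar> < \<epsilon> \<Longrightarrow> y r \<in> side vs i"
    using strips[OF assms nret] unfolding y_def by metis
  have y0: "y 0 = x" by (simp add: y_def)
  obtain D where D: "finite D" "nrm i \<in> D" "\<And>j z. j < length vs \<Longrightarrow> z \<in> D \<Longrightarrow> mirror (side_dir vs j) z \<in> D"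
    using finite_directions[OF assms(1) i] by metis
  have reg: "regular i x k" for k using e(3)[of 0] e(1) y0 by simp
  from e(2) obtain t where t: "\<And>k. strip i x \<epsilon> k (t k)" by metis
  define P W d l where "P = (\<lambda>k. fst (t k))" and "W = (\<lambda>k. fst (snd (t k)))" and "d = (\<lambda>k. fst (snd (snd (t k))))"
    and "l = (\<lambda>k. snd (snd (snd (t k))))"
  have st: "strip i x \<epsilon> k (P k, W k, d k, l k)" for k using t[of k] by (simp add: P_def W_def d_def l_def)
  have st': "orb i (y r) k = (P k + of_real r * W k, d k)" "good (l k) (P k + of_real r * W k, d k)" if "\<bar>r\<bar> < \<epsilon>" for k r
    using st[of k] that by (simp_all add: strip_def y_def)
  have st0: "orb i x k = (P k, d k)" "good (l k) (P k, d k)" for k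
    using st'[of 0 k] e(1) y0 by simp_all
  have ll: "l k < length vs" for k using good_active st0(2) by blast
  have dD: "d k \<in> D" for k using directions[OF D(2,3) reg[of k]] st0(1)[of k] by simp
  have "finite ((\<lambda>k. (l k, d k)) ` UNIV)"
    by (rule finite_subset[of _ "{..<length vs} \<times> D"]) (use ll dD D(1) in auto)
  then obtain k0 where inf: "infinite {k \<in> UNIV. (l k, d k) = (l k0, d k0)}"
    using pigeonhole_infinite[of "UNIV :: nat set" "\<lambda>k. (l k, d k)"] by auto
  have PK: "P k \<in> K" for k using good_region[OF st0(2)[of k]] by simp
  obtain k m where km: "k \<in> {k \<in> UNIV. (l k, d k) = (l k0, d k0)}" "m \<in> {k \<in> UNIV. (l k, d k) = (l k0, d k0)}" "k < m" "dist (P k) (P m) < \<epsilon>"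
    using infinite_close[OF inf compact_region _ e(1), of P] PK by blast
  have same: "l m = l k" "d m = d k" using km(1,2) by auto
  obtain w where w: "W k = of_real w * sgn (side_dir vs (l k))" "\<bar>w\<bar> \<ge> 1"
    using strip_along_side[OF st e(1)] by blast
  have Ps: "P k \<in> side vs (l k)" "P m \<in> side vs (l k)" using st0(2)[of k] st0(2)[of m] same by (auto simp: good_def)
  have "(P m - P k) \<bullet> nrm (l k) = 0"
    using on_side[OF Ps(1), of "P m"] on_side[OF Ps(2), of "P m"] by simp
  then obtain c where c: "P m - P k = of_real c * sgn (side_dir vs (l k))"
    using along_side[OF ll] by blast
  have "\<bar>c\<bar> = dist (P k) (P m)"
    using side_dir_nz[OF ll[of k]] c by (metis dist_commute dist_norm mult.right_neutral norm_mult norm_of_real norm_sgn)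
  then have "\<bar>c\<bar> < \<epsilon>" using km(4) by simp
  \<comment> \<open>The strip parameter whose trajectory passes through \<open>P m\<close> at
    collision \<open>k\<close>; it is admissible because the traces do not shrink.\<close>
  define r where "r = c / w"
  have "\<bar>r\<bar> \<le> \<bar>c\<bar>" using w(2) mult_left_mono[of 1 "\<bar>w\<bar>" "\<bar>c\<bar>"] by (simp add: r_def abs_divide divide_le_eq)
  then have r: "\<bar>r\<bar> < \<epsilon>" using \<open>\<bar>c\<bar> < \<epsilon>\<close> by simp
  have "r * w = c" using w(2) by (auto simp: r_def)
  then have "P m = P k + of_real r * W k" using c by (simp add: w(1) algebra_simps flip: of_real_mult)
  then have "orb i x m = orb i (y r) k" using st0(1)[of m] st'(1)[OF r, of k] same by simp
  \<comment> \<open>The orbits of \<open>x\<close> and \<open>y r\<close> share a state at the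
    different times \<open>m\<close> and \<open>k\<close>; for regular orbits this is
    impossible.\<close>
  then have "m = k" using orb_eq(2)[OF reg e(3)[OF r]] assms(3) e(4)[OF r] by blast
  then show False using km(3) by simp
qed

section \<open>From a perpendicular return to a periodic trajectory\<close>

lemma step_pow_rev_le:
  assumes "\<And>j. j \<le> k \<Longrightarrow> \<exists>i. good i ((step ^^ j) s)" "j \<le> k"
  shows "(step ^^ j) (rev_state ((step ^^ k) s)) = rev_state ((step ^^ (k - j)) s)"
proof -
  have pow: "(step ^^ a) ((step ^^ (k - j)) s) = (step ^^ (a + (k - j))) s" for a
    by (simp add: funpow_add)
  have "(step ^^ j) (rev_state ((step ^^ j) ((step ^^ (k - j)) s))) = rev_state ((step ^^ (k - j)) s)"
  proof (rule step_pow_rev)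
    show "\<exists>i. good i ((step ^^ a) ((step ^^ (k - j)) s))" if "a \<le> j" for a
      using assms(1)[of "a + (k - j)"] that assms(2) by (simp add: pow)
  qed
  then show ?thesis using assms(2) by (simp only: pow) simp
qed

lemma rev_normal: "good i (x, nrm i) \<Longrightarrow> rev_state (x, nrm i) = (x, nrm i)"
  using bounce_good[of i "(x, nrm i)"] mirror_normal[OF side_dir_nz nrm_cases] good_active
  by (simp add: rev_state_def)

text \<open>The state at the return foot \<open>y\<close> is its own reversal, so the next
  \<open>m\<close> collisions run the orbit backwards to the reversal of the initial state, which is
  that state itself. The period is therefore twice the return time.\<close>

lemma returns_periodic:
  assumes "returns i x" "x \<in> side vs i" "i < length vs"
  obtains m where "m \<ge> 1" "orb i x m = (x, nrm i)" "\<And>j. j \<le> m \<Longrightarrow> \<exists>l. good l (orb i x j)"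
proof -
  obtain m where m: "m \<ge> 1" "\<And>j. j \<le> m \<Longrightarrow> \<exists>l. good l (orb i x j)" "ret i (orb i x m)"
    using assms(1) by (auto simp: returns_def)
  obtain y where y: "orb i x m = (y, nrm i)" using m(3) by (metis ret_def prod.collapse)
  have gy: "good i (y, nrm i)"
    using m(2)[of m] m(3) good_unique assms(3) by (metis order_refl ret_def y)
  obtain l where "good l (orb i x 0)" using m(2)[of 0] by blast
  then have gx: "good i (x, nrm i)" using good_unique[of l "(x, nrm i)" i] assms(2,3) by simp
  have retrace: "orb i x (j + m) = rev_state (orb i x (m - j))" if "j \<le> m" for j
  proof -
    have "(step ^^ j) (rev_state ((step ^^ m) (x, nrm i))) = rev_state ((step ^^ (m - j)) (x, nrm i))"
      using m(2) that by (intro step_pow_rev_le) (simp_all add: orb_def)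
    moreover have "(step ^^ m) (x, nrm i) = (y, nrm i)" using y by (simp add: orb_def)
    ultimately show ?thesis by (simp add: orb_def funpow_add rev_normal[OF gy])
  qed
  show ?thesis
  proof
    show "m + m \<ge> 1" using m(1) by simp
    show "orb i x (m + m) = (x, nrm i)" using retrace[of m] rev_normal[OF gx] by simp
    show "\<exists>l. good l (orb i x j)" if "j \<le> m + m" for j
    proof (cases "j \<le> m")
      case False
      then have "orb i x j = rev_state (orb i x (m - (j - m)))" using retrace[of "j - m"] that by simp
      moreover obtain l where "good l (orb i x (m - (j - m)))" using m(2)[of "m - (j - m)"] by auto
      ultimately show ?thesis using good_rev by metis
    qed (use m in auto)
  qed
qed

text \<open>Starting at \<open>q\<close>, partway along the first chord, leads to the same first
  collision as starting at \<open>x\<close>. After \<open>m\<close> collisions the ball leaves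
  \<open>x\<close> perpendicularly and passes \<open>q\<close> at time \<open>s\<close> later,
  before the flight ends.\<close>

lemma periodic_of_returns:
  assumes "returns i x" "x \<in> side vs i" "active i" "x \<notin> set vs"
    and q: "q = x + of_real s * nrm i" "0 \<le> s" "s < flight_time K x (nrm i)"
  shows "billiard_periodic vs q (nrm i)"
proof -
  have i: "i < length vs" using assms(3) by (simp add: active_def)
  obtain m where m: "m \<ge> 1" "orb i x m = (x, nrm i)" "\<And>j. j \<le> m \<Longrightarrow> \<exists>l. good l (orb i x j)"
    using returns_periodic[OF assms(1,2) i] by blast
  define f where "f = flight_time K x (nrm i)"
  have x: "x \<in> K" "norm (nrm i) = 1" using side_subset assms(2) i norm_nrm by auto
  have "closed_segment x (x + of_real f * nrm i) \<subseteq> K"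
    using x flight_end[OF x] convex_region by (simp add: closed_segment_subset f_def)
  moreover have "q \<in> closed_segment x (x + of_real f * nrm i)"
    using q unfolding in_segment f_def [symmetric]
    by (intro exI[of _ "s / f"]) (auto simp: algebra_simps scaleR_conv_of_real)
  ultimately have qK: "q \<in> K" by blast
  have fq: "flight_time K q (nrm i) = f - s"
  proof (rule flight_eqI)
    show "q + of_real (f - s) * nrm i \<in> K"
      using flight_end[OF x] by (simp add: q(1) f_def algebra_simps)
    show "q + of_real t * nrm i \<notin> K" if "t > f - s" for t
    proof
      assume "q + of_real t * nrm i \<in> K"
      then have "x + of_real (s + t) * nrm i \<in> K" by (simp add: q(1) algebra_simps)
      then show False using flight_max[OF x, of "s + t"] that q(2,3) by (simp add: f_def)
    qed
  qed (use q(3) qK x in \<open>auto simp: f_def\<close>)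
  have "fst (step (q, nrm i)) = fst (step (x, nrm i))"
    unfolding fst_step fq by (simp add: q(1) f_def algebra_simps)
  then have "step (q, nrm i) = step (x, nrm i)"
    by (simp add: prod_eq_iff snd_step)
  then have col: "collision vs q (nrm i) (Suc k) = orb i x (Suc k)" for k
    by (simp add: collision_def orb_def funpow_swap1 step_def [symmetric])
  have col0: "collision vs q (nrm i) 0 = (q, nrm i)" by (simp add: collision_def)
  obtain m' where m': "m = Suc m'" using m(1) by (cases m) auto
  have colm: "collision vs q (nrm i) m = (x, nrm i)" using col[of m'] m(2) m' by simp
  have "0 < (\<Sum>j<m. flight_time K (fst (collision vs q (nrm i) j)) (snd (collision vs q (nrm i) j)))"
  proof (rule sum_pos)
    show "finite {..<m}" "{..<m} \<noteq> {}" using m' by auto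
    fix j assume "j \<in> {..<m}"
    show "0 < flight_time K (fst (collision vs q (nrm i) j)) (snd (collision vs q (nrm i) j))"
    proof (cases j)
      case 0
      then show ?thesis using fq q(3) by (simp add: col0 f_def)
    next
      case (Suc k)
      obtain l where "good l (orb i x j)" using m(3)[of j] \<open>j \<in> {..<m}\<close> by auto
      then show ?thesis using flight_pos[of l "fst (orb i x j)" "snd (orb i x j)"] col[of k] Suc by simp
    qed
  qed
  then have T: "0 < collision_time vs q (nrm i) m" by (simp add: collision_time_def)
  have "flow_at vs q (nrm i) (collision_time vs q (nrm i) m + s) (q, nrm i)"
    unfolding flow_at_def by (rule exI[of _ m], rule exI[of _ s]) (use q colm in simp)
  then show ?thesis unfolding billiard_periodic_def using T q(2) by (meson add_pos_nonneg)
qed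

text \<open>The alternative \<open>q = x\<close> covers boundary points, which are their own feet.
  In both cases \<open>q\<close> lies strictly before the end of its chord: an interior point leaves
  room ahead, and flights from good states have positive length.\<close>

lemma region_dichotomy:
  assumes "rational_polygon vs" "active i" "x \<in> side vs i"
    and "q = x + of_real s * nrm i" "0 \<le> s" "q \<in> interior K \<or> q = x"
    and "q \<notin> set vs" "\<not> (\<exists>\<phi>. norm \<phi> = 1 \<and> billiard_periodic vs q \<phi>)"
  shows "x \<in> exceptional i \<union> set vs"
proof (rule ccontr)
  assume nx: "x \<notin> exceptional i \<union> set vs"
  have i: "i < length vs" using assms(2) by (simp add: active_def)
  have x: "x \<in> K" "norm (nrm i) = 1" using side_subset assms(3) i norm_nrm by auto
  have "s < flight_time K x (nrm i)"
  proof (cases "q = x")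
    case True
    then have "s = 0" using assms(4) x(2) by auto
    then show ?thesis using flight_pos good_normal[OF assms(2,3)] nx by simp
  next
    case False
    then have "q \<in> interior K" using assms(6) by blast
    then obtain e where e: "e > 0" "cball q e \<subseteq> K" using mem_interior_cball by blast
    have "q + of_real e * nrm i \<in> K"
      using e x(2) by (intro subsetD[OF e(2)]) (simp add: dist_norm norm_mult)
    then have "x + of_real (s + e) * nrm i \<in> K" by (simp add: assms(4) algebra_simps)
    then have "s + e \<le> flight_time K x (nrm i)" using flight_max[OF x] assms(5) e(1) by simp
    then show ?thesis using e(1) by simp
  qed
  then have "billiard_periodic vs q (nrm i)"
    using periodic_of_returns nonexceptional_returns assms nx by blast
  then show False using assms(8) x(2) by blast
qed

subsection \<open>Points without a periodic direction\<close>

definition aperiodic :: "complex set" where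
  "aperiodic = {q \<in> K - set vs. \<not> (\<exists>\<phi>. cmod \<phi> = 1 \<and> billiard_periodic vs q \<phi>)}"

lemma aperiodic_segments:
  assumes "rational_polygon vs"
  shows "\<exists>S :: (complex \<times> complex) set. finite S \<and> aperiodic \<subseteq> (\<Union>(a, b)\<in>S. closed_segment a b)"
proof -
  \<comment> \<open>Bounds every chord; the added 1 makes the divisor in \<open>s / R\<close>
    positive.\<close>
  define R where "R = diameter K + 1"
  have R: "R > 0" using diameter_ge_0[OF compact_imp_bounded[OF compact_region]] by (simp add: R_def)
  define X where "X = (SIGMA i:{..<length vs}. exceptional i \<union> set vs)"
  define S where "S = (\<lambda>(i, x). (x, x + of_real R * nrm i)) ` X"
  have "finite X" unfolding X_def using finite_exceptional[OF assms] by (intro finite_SigmaI) auto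
  then have "finite S" by (simp add: S_def)
  moreover have "aperiodic \<subseteq> (\<Union>(a, b)\<in>S. closed_segment a b)"
  proof
    fix q assume "q \<in> aperiodic"
    then have q: "q \<in> K" "q \<notin> set vs" "\<not> (\<exists>\<phi>. norm \<phi> = 1 \<and> billiard_periodic vs q \<phi>)" by (auto simp: aperiodic_def)
    obtain i x s where ix: "active i" "x \<in> side vs i" "q = x + of_real s * nrm i" "0 \<le> s" "q \<in> interior K \<or> q = x"
    proof (cases "q \<in> interior K")
      case True
      then show ?thesis using foot that by metis
    next
      case False
      then have "q \<in> frontier K" using q(1) closed_region by (simp add: frontier_def)
      then obtain i where "active i" "q \<in> side vs i" using frontier_nonvertex q(2) by blast
      then show ?thesis using that[of i q 0] by simp
    qed
    have i: "i < length vs" using ix(1) by (simp add: active_def)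
    have "x \<in> exceptional i \<union> set vs" using region_dichotomy[OF assms ix q(2,3)] .
    then have "(x, x + of_real R * nrm i) \<in> S" using i by (force simp: S_def X_def)
    moreover have "q \<in> closed_segment x (x + of_real R * nrm i)"
    proof -
      have "x \<in> K" using side_subset i ix(2) by blast
      have "s = dist q x" using ix(3,4) norm_nrm[OF i] by (simp add: dist_norm norm_mult)
      also have "\<dots> \<le> diameter K"
        using diameter_bounded_bound[OF compact_imp_bounded[OF compact_region] q(1) \<open>x \<in> K\<close>] .
      finally have "s \<le> R" by (simp add: R_def)
      then show ?thesis using ix(3,4) R unfolding in_segment
        by (intro exI[of _ "s / R"]) (auto simp: algebra_simps scaleR_conv_of_real)
    qed
    ultimately show "q \<in> (\<Union>(a, b)\<in>S. closed_segment a b)" by blast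
  qed
  ultimately show ?thesis by blast
qed

section \<open>Triangles: feet on two adjacent sides\<close>

lemma foot_on_side:
  assumes "active i" "q \<in> K" "foot_within q (vtx vs i) (vtx vs (Suc i))"
  obtains x s where "x \<in> side vs i" "q = x + of_real s * nrm i" "0 \<le> s"
proof -
  define a b where "a = vtx vs i" and "b = vtx vs (Suc i)"
  have i: "i < length vs" using assms(1) by (simp add: active_def)
  have d: "side_dir vs i = b - a" by (simp add: a_def b_def side_dir_def)
  have D: "0 < (b - a) \<bullet> (b - a)" using side_dir_nz[OF i] d by auto
  define l where "l = ((q - a) \<bullet> (b - a)) / ((b - a) \<bullet> (b - a))"
  have f: "0 \<le> (q - a) \<bullet> (b - a)" "0 \<le> (q - b) \<bullet> (a - b)"
    using assms(3) by (auto simp: foot_within_def a_def b_def)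
  have "(q - b) \<bullet> (a - b) = (b - a) \<bullet> (b - a) - (q - a) \<bullet> (b - a)"
    by (simp add: inner_diff_left inner_diff_right inner_commute)
  then have l: "0 \<le> l" "l \<le> 1" using D f by (auto simp: l_def divide_le_eq)
  define x where "x = (1 - l) *\<^sub>R a + l *\<^sub>R b"
  have x: "x \<in> side vs i" using l unfolding side_def in_segment x_def a_def b_def by blast
  have "q - x = (q - a) - l *\<^sub>R (b - a)" by (simp add: x_def algebra_simps)
  then have "(q - x) \<bullet> (b - a) = (q - a) \<bullet> (b - a) - l * ((b - a) \<bullet> (b - a))"
    by (metis inner_diff_left inner_scaleR_left)
  moreover have "l * ((b - a) \<bullet> (b - a)) = (q - a) \<bullet> (b - a)"
    by (metis D l_def less_irrefl nonzero_eq_divide_eq)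
  ultimately have "(q - x) \<bullet> (b - a) = 0" by simp
  then have "(q - x) \<bullet> side_dir vs i = 0" by (simp add: d)
  from perp_eq_scaled_normal[OF side_dir_nz[OF i] this] obtain c where "q - x = of_real c * (\<i> * sgn (side_dir vs i))" by blast
  then have "q - x = of_real c * nrm i \<or> q - x = of_real (- c) * nrm i" using nrm_cases[of i] by auto
  then obtain s where s: "q - x = of_real s * nrm i" by blast
  have "0 \<le> (q - x) \<bullet> nrm i" using active_support[OF assms(1) x assms(2)] .
  then have "0 \<le> s" using norm_nrm[OF i] unfolding s by (simp add: dot_square_norm flip: scaleR_conv_of_real)
  moreover have "q = x + of_real s * nrm i" using s by (simp add: algebra_simps)
  ultimately show ?thesis using x that by blast
qed

lemma vtx_mod: "vtx vs (i mod length vs) = vtx vs i" "vtx vs (Suc (i mod length vs)) = vtx vs (Suc i)"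
  by (simp_all add: vtx_def mod_Suc_eq)

lemma side_dir_mod: "side_dir vs (i mod length vs) = side_dir vs i"
  by (simp add: side_dir_def vtx_mod)

text \<open>Quarter turns of both directions change their cross product at most in sign, and
  consecutive sides are not parallel.\<close>

lemma nrm_not_parallel:
  assumes "i < length vs"
  shows "Im (cnj (nrm i) * nrm (Suc i mod length vs)) \<noteq> 0"
proof -
  define d e where "d = side_dir vs i" and "e = side_dir vs (Suc i)"
  have j: "Suc i mod length vs < length vs" using assms by (intro mod_less_divisor) auto
  have nz: "d \<noteq> 0" "e \<noteq> 0"
    using side_dir_nz[OF assms] side_dir_nz[OF j] by (auto simp: d_def e_def side_dir_mod)
  have "Im (cnj d * e) \<noteq> 0" using corner[OF assms] by (simp add: d_def e_def)
  moreover have "cnj d * e = (norm d * norm e) *\<^sub>R (cnj (sgn d) * sgn e)"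
    using nz by (simp add: sgn_eq scaleR_conv_of_real)
  ultimately have ne: "Im (cnj (sgn d) * sgn e) \<noteq> 0" by (metis scaleR_complex.sel(2) mult_zero_right)
  have "cnj (nrm i) * nrm (Suc i mod length vs) = cnj (sgn d) * sgn e \<or>
    cnj (nrm i) * nrm (Suc i mod length vs) = - (cnj (sgn d) * sgn e)"
    using nrm_cases[of i] nrm_cases[of "Suc i mod length vs"] unfolding side_dir_mod d_def [symmetric] e_def [symmetric]
    by (elim disjE) (simp_all add: algebra_simps)
  then show ?thesis using ne by (metis neg_equal_0_iff_equal uminus_complex.simps(2))
qed

lemma triangle_aperiodic_finite:
  assumes "rational_polygon vs" "length vs = 3" 
    and K: "K = convex hull {vtx vs 0, vtx vs 1, vtx vs 2}"
    and fr: "frontier K = poly_boundary vs"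
  shows "finite aperiodic"
proof -
  \<comment> \<open>The midpoint of side \<open>i\<close> is a frontier point and no vertex, so some
    active side passes through it, and that side can only be \<open>i\<close>.\<close>
  have act: "active i" if i: "i < length vs" for i
  proof -
    define m where "m = midpoint (vtx vs i) (vtx vs (Suc i))"
    have ms: "m \<in> side vs i" by (simp add: m_def side_def)
    have b: "2 *\<^sub>R m = vtx vs i + vtx vs (Suc i)" by (simp add: m_def midpoint_def)
    have "m \<notin> set vs"
    proof
      assume "m \<in> set vs"
      then obtain k where k: "k < length vs" "m = vtx vs k" using ex_vtx_iff by blast
      have "k = i mod length vs \<or> k = Suc i mod length vs \<or> k = Suc (Suc i) mod length vs"
      proof -
        have "i = 0 \<or> i = 1 \<or> i = 2" "k = 0 \<or> k = 1 \<or> k = 2" using k(1) i assms(2) by auto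
        then show ?thesis by (elim disjE) (simp_all add: assms(2))
      qed
      then have "m = vtx vs i \<or> m = vtx vs (Suc i) \<or> m = vtx vs (Suc (Suc i))"
        using k(2) by (auto simp: vtx_def)
      \<comment> \<open>Being an endpoint would make the side degenerate; being the third vertex
        would make consecutive sides parallel.\<close>
      then have "side_dir vs i = 0 \<or> 2 *\<^sub>R side_dir vs (Suc i) = - side_dir vs i"
        using b unfolding side_dir_def by (auto simp: scaleR_2 algebra_simps)
      moreover have "Im (cnj (side_dir vs i) * (2 *\<^sub>R side_dir vs (Suc i))) \<noteq> 0"
        using corner[OF i] by simp
      ultimately show False using side_dir_nz[OF i] by auto
    qed
    moreover have "m \<in> frontier K" using ms i by (auto simp: fr poly_boundary_def)
    ultimately obtain j where j: "active j" "m \<in> side vs j" using frontier_nonvertex by blast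
    then have "i = j" using side_unique[OF i _ ms j(2)] \<open>m \<notin> set vs\<close> by (simp add: active_def)
    then show ?thesis using j by simp
  qed
  define E where "E = (\<lambda>i. exceptional i \<union> set vs)"
  have finE: "finite (E i)" if "i < length vs" for i using finite_exceptional[OF assms(1) that] by (simp add: E_def)
  define line where "line = (\<lambda>i x. {x + of_real s * nrm i | s. True})"
  \<comment> \<open>The first union catches boundary points, the second the crossings of
    perpendiculars to adjacent sides.\<close>
  define A where "A = (\<Union>i<length vs. E i) \<union>
    (\<Union>i<length vs. \<Union>x\<in>E i. \<Union>y\<in>E (Suc i mod length vs). line i x \<inter> line (Suc i mod length vs) y)"
  have "Suc i mod length vs < length vs" for i using assms(2) by simp
  then have "finite A"
    unfolding A_def line_def using finE nrm_not_parallel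
    by (intro finite_UnI finite_UN_I finite_line_inter) auto
  moreover have "aperiodic \<subseteq> A"
  proof
    fix q assume "q \<in> aperiodic"
    then have q: "q \<in> K" "q \<notin> set vs" "\<not> (\<exists>\<phi>. norm \<phi> = 1 \<and> billiard_periodic vs q \<phi>)" by (auto simp: aperiodic_def)
    show "q \<in> A"
    proof (cases "q \<in> interior K")
      case False
      then have "q \<in> frontier K" using q(1) closed_region by (simp add: frontier_def)
      then obtain i where i: "active i" "q \<in> side vs i" using frontier_nonvertex q(2) by blast
      then have "q \<in> E i" using region_dichotomy[OF assms(1) i, of q 0] q by (simp add: E_def)
      then show ?thesis using i(1) by (auto simp: A_def active_def)
    next
      case True
      define F where "F = (\<lambda>i. foot_within q (vtx vs i) (vtx vs (Suc i)))"
      have fw: "\<exists>x\<in>E i. q \<in> line i x" if il: "i < length vs" and Fi: "F i" for i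
      proof -
        obtain x s where xs: "x \<in> side vs i" "q = x + of_real s * nrm i" "0 \<le> s"
          using foot_on_side[OF act[OF il] q(1) Fi[unfolded F_def]] .
        then have "x \<in> E i" using region_dichotomy[OF assms(1) act[OF il] xs] True q(2,3) by (simp add: E_def)
        then show ?thesis using xs(2) by (auto simp: line_def)
      qed
      have "vtx vs (Suc 0) = vtx vs 1" "vtx vs (Suc 1) = vtx vs 2" "vtx vs (Suc 2) = vtx vs 0"
        using assms(2) by (simp_all add: vtx_def numeral_2_eq_2)
      then have "F 0 \<and> F 1 \<or> F 1 \<and> F 2 \<or> F 2 \<and> F 0"
        using triangle_two_feet[of q "vtx vs 0" "vtx vs 1" "vtx vs 2"] q(1) unfolding K F_def by simp
      then have "\<exists>i<length vs. F i \<and> F (Suc i mod length vs)"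
      proof (elim disjE)
        assume "F 0 \<and> F 1"
        then show ?thesis using assms(2) by (intro exI[of _ 0]) simp
      next
        assume "F 1 \<and> F 2"
        then show ?thesis using assms(2) by (intro exI[of _ 1]) (simp add: numeral_2_eq_2)
      next
        assume "F 2 \<and> F 0"
        then show ?thesis using assms(2) by (intro exI[of _ 2]) simp
      qed
      then obtain i where i: "i < length vs" "F i" "F (Suc i mod length vs)" by blast
      have "Suc i mod length vs < length vs" using assms(2) by simp
      then obtain x y where "x \<in> E i" "q \<in> line i x" "y \<in> E (Suc i mod length vs)" "q \<in> line (Suc i mod length vs) y"
        using fw[OF i(1,2)] fw[OF _ i(3)] by blast
      then show ?thesis using i(1) unfolding A_def by blast
    qed
  qed
  ultimately show ?thesis using finite_subset by blast
qed

end

lemma triangle_region: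
  assumes "length vs = 3"
  shows "poly_region vs = convex hull {vtx vs 0, vtx vs 1, vtx vs 2}"
    and "frontier (poly_region vs) = poly_boundary vs"
proof -
  define a b c where "a = vtx vs 0" and "b = vtx vs 1" and "c = vtx vs 2"
  define T where "T = convex hull {a, b, c}"
  have "{..<length vs} = {0, 1, 2}" using assms by auto
  moreover have "vtx vs (Suc 0) = b" "vtx vs (Suc 1) = c" "vtx vs (Suc 2) = a"
    using assms by (simp_all add: vtx_def a_def b_def c_def numeral_2_eq_2)
  ultimately have bd: "poly_boundary vs = closed_segment a b \<union> closed_segment b c \<union> closed_segment c a"
    unfolding poly_boundary_def side_def by (auto simp: a_def b_def c_def)
  then have fr: "poly_boundary vs = frontier T" by (simp add: frontier_of_triangle T_def)
  have "inside (poly_boundary vs) = interior T" by (simp add: bd inside_of_triangle T_def)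
  moreover have "closed T" unfolding T_def by (intro compact_imp_closed finite_imp_compact_convex_hull) simp
  ultimately have "poly_region vs = T"
    using interior_subset[of T] by (auto simp: poly_region_def fr frontier_def)
  then show "poly_region vs = convex hull {vtx vs 0, vtx vs 1, vtx vs 2}" "frontier (poly_region vs) = poly_boundary vs"
    using fr by (simp_all add: T_def a_def b_def c_def)
qed

theorem theorem4:
  fixes vs :: "complex list"
  assumes "rational_polygon vs"
  defines "B \<equiv> {q \<in> poly_region vs - set vs.
                  \<not> (\<exists>\<phi>. cmod \<phi> = 1 \<and> billiard_periodic vs q \<phi>)}"
  shows "(convex (poly_region vs) \<longrightarrow>
            (\<exists>S :: (complex \<times> complex) set. finite S \<and> B \<subseteq> (\<Union>(a, b)\<in>S. closed_segment a b)))
         \<and> (length vs = 3 \<longrightarrow> finite B)"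
proof (intro conjI impI)
  have simple: "simple_polygon vs" using assms(1) by (simp add: rational_polygon_def)
  show "\<exists>S :: (complex \<times> complex) set. finite S \<and> B \<subseteq> (\<Union>(a, b)\<in>S. closed_segment a b)"
    if "convex (poly_region vs)"
  proof -
    interpret convex_polygon vs using simple that by (rule convex_polygon.intro)
    show ?thesis using aperiodic_segments[OF assms(1)] unfolding B_def aperiodic_def .
  qed
  show "finite B" if "length vs = 3"
  proof -
    have "convex (poly_region vs)" unfolding triangle_region(1)[OF that] by (rule convex_convex_hull)
    with simple interpret convex_polygon vs by (rule convex_polygon.intro)
    show ?thesis
      using triangle_aperiodic_finite[OF assms(1) that triangle_region[OF that]] unfolding B_def aperiodic_def .
  qed
qed

end
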